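(* Let $P$ be a tree poset of height $h$ and let $x\in P$ be such that every element of $P$ is at distance at most $2$ from $x$ in the undirected Hasse diagram of $P$. Then for every $\varepsilon>0$ there exists $\delta>0$ such that for every sufficiently large $n\in\mathbb N$ the following holds: every family $\mathcal F\subseteq 2^{[n]}$ with $|\mathcal F|\ge (h-1+\varepsilon)\binom{n}{\lfloor n/2\rfloor}$ contains a copy of the blow-up $P(x,\delta n)$.
   Context: Posets are finite collections of finite sets ordered by inclusion. A poset homomorphism $\phi:P\to Q$ is a map with $A\subseteq B\Rightarrow \phi(A)\subseteq\phi(B)$; $Q$ contains a copy of $P$ if there is an injective poset homomorphism $P\to Q$. The Hasse diagram of $P$ is the directed graph on $P$ with an edge $A\to B$ when $A\subsetneq B$ and no $C\in P$ has $A\subsetneq C\subsetneq B$; the undirected Hasse diagram forgets orientations. A tree poset is a poset whose undirected Hasse diagram is a tree. The height of $P$ is the number of elements of a longest chain in $P$. For a tree poset $P$, $x\in P$ and an integer $d\ge2$, the $d$-blow-up $P(x,d)$ rooted at $x$ is the tree poset whose Hasse diagram is obtained as follows: each $u\in P$ at distance $\rho$ from $x$ in the undirected Hasse diagram is replaced by $d^{\rho}$ elements $u^1,\dots,u^{d^\rho}$; for each edge $uv$ of the Hasse diagram with $v$ at distance $\rho-1$ from $x$ (and $u$ at distance $\rho$), the $u^i$ are partitioned into $d^{\rho-1}$ disjoint sets $U^1,\dots,U^{d^{\rho-1}}$ of size $d$ and $v^j$ is joined to every element of $U^j$, with the same orientation as the edge $uv$. The parameter $\delta n$ is rounded down to an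 integer. *)

theory Defs
  imports Complex_Main
begin

text \<open>Posets are finite collections of finite sets ordered by inclusion.\<close>

definition hasse_edge :: "'a set set \<Rightarrow> 'a set \<Rightarrow> 'a set \<Rightarrow> bool" where
  "hasse_edge P A B \<longleftrightarrow> A \<in> P \<and> B \<in> P \<and> A \<subset> B \<and> \<not> (\<exists>C\<in>P. A \<subset> C \<and> C \<subset> B)"

text \<open>Undirected Hasse diagram: adjacency relation.\<close>
definition hasse_adj :: "'a set set \<Rightarrow> ('a set \<times> 'a set) set" where
  "hasse_adj P = {(A, B). hasse_edge P A B \<or> hasse_edge P B A}"

text \<open>Undirected edges as unordered pairs.\<close>
definition hasse_uedges :: "'a set set \<Rightarrow> 'a set set set" where
  "hasse_uedges P = {{A, B} | A B. hasse_edge P A B}"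

text \<open>Graph distance in the undirected Hasse diagram.\<close>
definition hdist :: "'a set set \<Rightarrow> 'a set \<Rightarrow> 'a set \<Rightarrow> nat" where
  "hdist P A B = (LEAST k. (A, B) \<in> hasse_adj P ^^ k)"

definition is_poset :: "'a set set \<Rightarrow> bool" where
  "is_poset P \<longleftrightarrow> finite P \<and> (\<forall>A\<in>P. finite A)"

text \<open>A tree poset: the undirected Hasse diagram is a tree
  (nonempty, connected, and with exactly |P| - 1 edges).\<close>
definition tree_poset :: "'a set set \<Rightarrow> bool" where
  "tree_poset P \<longleftrightarrow> is_poset P \<and> P \<noteq> {} \<and>
     (\<forall>A\<in>P. \<forall>B\<in>P. (A, B) \<in> (hasse_adj P)\<^sup>*) \<and>
     card (hasse_uedges P) = card P - 1"

definition is_chain :: "'a set set \<Rightarrow> bool" where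
  "is_chain C \<longleftrightarrow> (\<forall>A\<in>C. \<forall>B\<in>C. A \<subseteq> B \<or> B \<subseteq> A)"

text \<open>Height: number of elements of a longest chain.\<close>
definition height :: "'a set set \<Rightarrow> nat" where
  "height P = Max {card C | C. C \<subseteq> P \<and> is_chain C}"

text \<open>The d-blow-up P(x,d) rooted at x: element u at distance rho from x is
  replaced by copies (u,i), i < d^rho.  For a Hasse edge between u (distance rho)
  and v (distance rho-1), the copies of u are partitioned into the blocks
  {i. i div d = j}, j < d^(rho-1), of size d, and v^j is joined to the j-th block,
  with the same orientation as the edge.\<close>
definition blowup_vertices :: "'a set set \<Rightarrow> 'a set \<Rightarrow> nat \<Rightarrow> ('a set \<times> nat) set" where
  "blowup_vertices P x d = {(u, i). u \<in> P \<and> i < d ^ hdist P x u}"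

text \<open>Directed Hasse edges of the blow-up (lower element first).\<close>
definition blowup_edges :: "'a set set \<Rightarrow> 'a set \<Rightarrow> nat \<Rightarrow> (('a set \<times> nat) \<times> ('a set \<times> nat)) set" where
  "blowup_edges P x d = {((a, i), (b, j)).
      (a, i) \<in> blowup_vertices P x d \<and> (b, j) \<in> blowup_vertices P x d \<and> hasse_edge P a b \<and>
      ((hdist P x b = hdist P x a + 1 \<and> i = j div d) \<or>
       (hdist P x a = hdist P x b + 1 \<and> j = i div d))}"

text \<open>The order of the blow-up is the reflexive-transitive closure of its Hasse edges.
  Q contains a copy of it if there is an injective order-preserving map into Q.\<close>
definition contains_blowup :: "nat set set \<Rightarrow> 'a set set \<Rightarrow> 'a set \<Rightarrow> nat \<Rightarrow> bool" where
  "contains_blowup F P x d \<longleftrightarrow>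
     (\<exists>\<phi>. inj_on \<phi> (blowup_vertices P x d) \<and> \<phi> ` blowup_vertices P x d \<subseteq> F \<and>
        (\<forall>p\<in>blowup_vertices P x d. \<forall>q\<in>blowup_vertices P x d.
            (p, q) \<in> (blowup_edges P x d)\<^sup>* \<longrightarrow> \<phi> p \<subseteq> \<phi> q))"

end

theory Submission
  imports Defs "HOL-Combinatorics.Multiset_Permutations"
begin

text \<open>Let \<open>a\<close> and \<open>b\<close> be the lengths of the longest chains strictly below and above \<open>x\<close>, so that \<open>P\<close>
  has height at least \<open>a + b + 1\<close>. Sets of size outside
  \<open>[n/4, 3n/4]\<close> are negligible. Call \<open>A\<close> rich in a direction if \<open>F\<close> has at least \<open>cn\<close> members at Hamming
  distance one or at least \<open>cn\<^sup>2\<close> members in that direction. If \<open>A\<close> is poor, a random maximal chain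
  through \<open>A\<close> continues in that direction inside \<open>F\<close> only with probability \<open>O(c)\<close>. A random maximal
  chain meets \<open>F\<close> in at least \<open>a + b + eps/2\<close> sets on average, so some element of \<open>F\<close> has many
  neighbours in \<open>F\<close> above and below it that are rich in all directions needed. The blow-up is then
  embedded greedily around this element.\<close>

section \<open>Maximal chains through given sets\<close>

text \<open>A maximal chain of subsets of \<open>S\<close> is encoded as an enumeration \<open>xs\<close> of \<open>S\<close>, its members being the
  sets of elements of the prefixes of \<open>xs\<close>.\<close>

definition passing :: "'a set \<Rightarrow> 'a set \<Rightarrow> 'a list set" where
  "passing S A = {xs \<in> permutations_of_set S. set (take (card A) xs) = A}"

text \<open>An enumeration passing through \<open>A\<close> and \<open>B\<close> is the
  concatenation of enumerations of \<open>A\<close>, \<open>B - A\<close> and \<open>S - B\<close>,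
  in a unique way because the lengths are fixed.\<close>

lemma card_passing2:
  assumes S: "finite S" and AB: "A \<subseteq> B" "B \<subseteq> S"
  shows "card (passing S A \<inter> passing S B) =
    fact (card A) * fact (card B - card A) * fact (card S - card B)"
proof -
  let ?p = "\<lambda>T. permutations_of_set T"
  let ?f = "\<lambda>(ys, zs, ws). ys @ zs @ ws"
  have fin: "finite A" "finite B"
    using S AB by (auto intro: finite_subset)
  have cAB: "card A \<le> card B" using AB(1) fin by (simp add: card_mono)
  have len: "length ys = card T" if "ys \<in> ?p T" for ys :: "'a list" and T
    using that by (auto simp: permutations_of_set_def distinct_card)
  have "passing S A \<inter> passing S B = ?f ` (?p A \<times> ?p (B - A) \<times> ?p (S - B))"
  proof (intro equalityI subsetI)
    fix xs assume xs: "xs \<in> passing S A \<inter> passing S B"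
    define ys zs ws where "ys = take (card A) xs"
      and "zs = take (card B - card A) (drop (card A) xs)" and "ws = drop (card B) xs"
    have d: "distinct xs" "set xs = S" using xs by (auto simp: passing_def permutations_of_set_def)
    have tB: "take (card B) xs = ys @ zs"
      using cAB by (simp add: ys_def zs_def take_add [symmetric])
    have xs_eq: "xs = ys @ zs @ ws"
      using append_take_drop_id[of "card B" xs] unfolding tB ws_def by simp
    have sy: "set ys = A" and syz: "set ys \<union> set zs = B"
      using xs arg_cong[OF tB, of set] by (auto simp: passing_def ys_def)
    have "set zs = B - A" "set ws = S - B"
      using d sy syz unfolding xs_eq by auto
    then have "ys \<in> ?p A" "zs \<in> ?p (B - A)" "ws \<in> ?p (S - B)"
      using d sy unfolding xs_eq by (auto simp: permutations_of_set_def)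
    then show "xs \<in> ?f ` (?p A \<times> ?p (B - A) \<times> ?p (S - B))"
      unfolding xs_eq by (auto intro!: image_eqI[of _ _ "(ys, zs, ws)"])
  next
    fix xs assume "xs \<in> ?f ` (?p A \<times> ?p (B - A) \<times> ?p (S - B))"
    then obtain ys zs ws where xs: "xs = ys @ zs @ ws"
      and p: "ys \<in> ?p A" "zs \<in> ?p (B - A)" "ws \<in> ?p (S - B)" by auto
    have l: "length ys = card A" "length zs = card B - card A"
      using len[OF p(1)] len[OF p(2)] AB fin by (auto simp: card_Diff_subset)
    have "xs \<in> ?p S" using p AB unfolding xs by (auto simp: permutations_of_set_def)
    moreover have "set (take (card A) xs) = A" "set (take (card B) xs) = B"
      using l p AB cAB unfolding xs by (auto simp: permutations_of_set_def)
    ultimately show "xs \<in> passing S A \<inter> passing S B" by (auto simp: passing_def)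
  qed
  moreover have "inj_on ?f (?p A \<times> ?p (B - A) \<times> ?p (S - B))"
    by (auto simp: inj_on_def dest!: len)
  ultimately have "card (passing S A \<inter> passing S B) = card (?p A \<times> ?p (B - A) \<times> ?p (S - B))"
    by (simp add: card_image)
  also have "\<dots> = fact (card A) * fact (card B - card A) * fact (card S - card B)"
    using S AB fin by (simp add: card_cartesian_product card_Diff_subset)
  finally show ?thesis .
qed

lemma card_passing:
  assumes "finite S" "A \<subseteq> S"
  shows "card (passing S A) = fact (card A) * fact (card S - card A)"
  using card_passing2[of S A A] assms by simp

lemma card_passing_binomial:
  assumes "finite S" "A \<subseteq> S"
  shows "real (card (passing S A)) = fact (card S) / real (card S choose card A)"
proof -
  have "card A \<le> card S" using assms by (simp add: card_mono)
  then show ?thesis using assms by (simp add: card_passing binomial_fact)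
qed

text \<open>Read as conditional probabilities: given that a random maximal chain passes through the
  lower (upper) of the two sets, the other one is equally likely to be any set of its size above
  (below) it.\<close>

lemma card_passing2_binomial:
  assumes S: "finite S" and AB: "A \<subseteq> B" "B \<subseteq> S"
  shows "real (card (passing S A \<inter> passing S B)) =
      real (card (passing S A)) / real ((card S - card A) choose (card B - card A))" (is ?t1)
    and "real (card (passing S A \<inter> passing S B)) =
      real (card (passing S B)) / real (card B choose (card B - card A))" (is ?t2)
proof -
  have fin: "finite A" "finite B" using S AB by (auto intro: finite_subset)
  have le: "card A \<le> card B" "card B \<le> card S"
    using S AB fin by (auto simp: card_mono)
  have e: "card S - card A - (card B - card A) = card S - card B"
    "card B - (card B - card A) = card A" using le by auto
  show ?t1 using AB le S by (simp add: card_passing2 card_passing binomial_fact e)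
  show ?t2 using AB le S by (simp add: card_passing2 card_passing binomial_fact e)
qed

section \<open>How likely a chain through a set is to meet given comparable sets\<close>

lemma choose_two_le:
  assumes "2 \<le> t" "t + 2 \<le> N"
  shows "N choose 2 \<le> N choose t"
proof (cases "2 * t \<le> N")
  case True
  then show ?thesis using assms by (intro binomial_mono) auto
next
  case False
  then have "N choose 2 \<le> N choose (N - t)" using assms by (intro binomial_mono) auto
  then show ?thesis using assms binomial_symmetric[of t N] by simp
qed

text \<open>Going up from \<open>A\<close> to \<open>B\<close>, \<open>N\<close> is the size of the
  complement of \<open>A\<close>; going down, it is the size of \<open>A\<close>. In both cases
  \<open>t\<close> is the difference of the sizes. For \<open>t\<close> at least 2 unimodality
  reduces to \<open>N choose 2\<close>, and \<open>8 \<le> n\<close> gives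
  \<open>N - 1 \<ge> n / 8\<close>.\<close>

lemma inverse_choose_le:
  assumes n: "8 \<le> n" and N: "n \<le> 4 * N" and t: "0 < t" "n \<le> 4 * (N - t)"
  shows "t = 1 \<Longrightarrow> 1 / real (N choose t) \<le> 4 / real n"
    and "t \<noteq> 1 \<Longrightarrow> 1 / real (N choose t) \<le> 64 / (real n)\<^sup>2"
proof -
  assume "t = 1"
  then show "1 / real (N choose t) \<le> 4 / real n" using n N by (simp add: field_simps)
next
  assume "t \<noteq> 1"
  then have "2 \<le> t" "t + 2 \<le> N" using assms by auto
  then have "N choose 2 \<le> N choose t" by (rule choose_two_le)
  then have "real (N choose 2) \<le> real (N choose t)" by linarith
  moreover have "real (N choose 2) = real N * (real N - 1) / 2"
    using N n by (simp add: choose_two real_of_nat_div of_nat_diff)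
  moreover have "(real n)\<^sup>2 / 64 \<le> real N * (real N - 1) / 2"
  proof -
    have "real n / 4 * (real n / 8) \<le> real N * (real N - 1)"
      using n N by (intro mult_mono) auto
    then show ?thesis by (simp add: power2_eq_square)
  qed
  ultimately have "(real n)\<^sup>2 / 64 \<le> real (N choose t)" by linarith
  moreover have "0 < (real n)\<^sup>2 / 64" using n by simp
  ultimately have "1 / real (N choose t) \<le> 1 / ((real n)\<^sup>2 / 64)" by (intro divide_left_mono mult_pos_pos) linarith+
  then show "1 / real (N choose t) \<le> 64 / (real n)\<^sup>2" by simp
qed

text \<open>Factors 4 and 3 instead of quotients avoid rounding. A central set leaves room for at
  least \<open>card S / 4\<close> elements in either direction.\<close>

definition central :: "'a set \<Rightarrow> 'a set set" where
  "central S = {A. A \<subseteq> S \<and> card S \<le> 4 * card A \<and> 4 * card A \<le> 3 * card S}"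

text \<open>The symmetric difference treats both directions at once: for comparable sets its size is
  the difference of the sizes, which is the \<open>t\<close> of
  \<open>inverse_choose_le\<close>.\<close>

lemma passing2_le:
  assumes S: "finite S" "8 \<le> card S" and A: "A \<in> central S" and B: "B \<in> central S"
    and comp: "A \<subset> B \<or> B \<subset> A"
  shows "card (sym_diff A B) = 1 \<Longrightarrow>
      real (card (passing S A \<inter> passing S B)) \<le> 4 / card S * card (passing S A)" (is "?d1 \<Longrightarrow> ?t1")
    and "card (sym_diff A B) \<noteq> 1 \<Longrightarrow>
      real (card (passing S A \<inter> passing S B)) \<le> 64 / (real (card S))\<^sup>2 * card (passing S A)" (is "_ \<Longrightarrow> ?t2")
proof -
  have fin: "finite A" "finite B" and sub: "A \<subseteq> S" "B \<subseteq> S"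
    using A B S by (auto simp: central_def intro: finite_subset)
  have "(?d1 \<longrightarrow> ?t1) \<and> (\<not> ?d1 \<longrightarrow> ?t2)"
  proof (cases "A \<subset> B")
    case True
    have sd: "card (sym_diff A B) = card B - card A"
    proof -
      have "sym_diff A B = B - A" using True by auto
      then show ?thesis using True fin by (simp add: card_Diff_subset)
    qed
    have lt: "card A < card B" using True fin by (simp add: psubset_card_mono)
    have leB: "card B \<le> card S" using S sub by (simp add: card_mono)
    have eq: "real (card (passing S A \<inter> passing S B)) =
      card (passing S A) * (1 / real ((card S - card A) choose (card B - card A)))"
      using card_passing2_binomial(1)[OF S(1) psubset_imp_subset[OF True] sub(2)] by simp
    have "card S \<le> 4 * (card S - card A)" "0 < card B - card A"
      "card S \<le> 4 * (card S - card A - (card B - card A))"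
      using A B lt leB by (auto simp: central_def)
    note i = inverse_choose_le[OF S(2) this]
    show ?thesis unfolding eq sd
      using mult_left_mono[OF i(1), of "real (card (passing S A))"]
        mult_left_mono[OF i(2), of "real (card (passing S A))"] by (auto simp: mult.commute)
  next
    case False
    then have BA: "B \<subset> A" using comp by auto
    have sd: "card (sym_diff A B) = card A - card B"
    proof -
      have "sym_diff A B = A - B" using BA by auto
      then show ?thesis using BA fin by (simp add: card_Diff_subset)
    qed
    have lt: "card B < card A" using BA fin by (simp add: psubset_card_mono)
    have eq: "real (card (passing S A \<inter> passing S B)) =
      card (passing S A) * (1 / real (card A choose (card A - card B)))"
      using card_passing2_binomial(2)[OF S(1) psubset_imp_subset[OF BA] sub(1)] by (simp add: Int_commute)
    have "card S \<le> 4 * card A" "0 < card A - card B"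
      "card S \<le> 4 * (card A - (card A - card B))"
      using A B lt by (auto simp: central_def)
    note i = inverse_choose_le[OF S(2) this]
    show ?thesis unfolding eq sd
      using mult_left_mono[OF i(1), of "real (card (passing S A))"]
        mult_left_mono[OF i(2), of "real (card (passing S A))"] by (auto simp: mult.commute)
  qed
  then show "?d1 \<Longrightarrow> ?t1" "\<not> ?d1 \<Longrightarrow> ?t2" by auto
qed

definition cube_nbrs :: "'a set \<Rightarrow> 'a set set" where
  "cube_nbrs A = {B. card (sym_diff A B) = 1}"

text \<open>The two thresholds match the two scales in \<open>passing2_le\<close>: a chain through
  \<open>A\<close> hits a given set at distance one with probability \<open>O(1/n)\<close> and a
  farther one with probability \<open>O(1/n^2)\<close>.\<close>

definition rich :: "real \<Rightarrow> nat \<Rightarrow> 'a set \<Rightarrow> 'a set set \<Rightarrow> bool" where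
  "rich c n A T \<longleftrightarrow> c * real n \<le> real (card (T \<inter> cube_nbrs A)) \<or>
     c * (real n)\<^sup>2 \<le> real (card T)"

text \<open>Fewer than \<open>c * n\<close> sets of weight \<open>4 / n\<close> and fewer than
  \<open>c * n^2\<close> sets of weight \<open>64 / n^2\<close> contribute, and 68 = 4 + 64.\<close>

lemma poor_passing_le:
  assumes S: "finite S" "8 \<le> card S" and A: "A \<in> central S" and T: "T \<subseteq> central S"
    and comp: "\<And>B. B \<in> T \<Longrightarrow> A \<subset> B \<or> B \<subset> A" and poor: "\<not> rich c (card S) A T"
  shows "(\<Sum>B\<in>T. real (card (passing S A \<inter> passing S B))) \<le> 68 * c * card (passing S A)"
proof -
  let ?n = "real (card S)" and ?p = "real (card (passing S A))"
  let ?w = "\<lambda>B. real (card (passing S A \<inter> passing S B))"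
  define T1 T2 where "T1 = T \<inter> cube_nbrs A" and "T2 = T - T1"
  have finT: "finite T" using T S by (auto simp: central_def intro: finite_subset[of T "Pow S"])
  then have fin: "finite T1" "finite T2" by (auto simp: T1_def T2_def)
  have n: "0 < ?n" using S by auto
  have c1: "real (card T1) \<le> c * ?n" and c2: "real (card T) \<le> c * ?n\<^sup>2"
    using poor by (auto simp: rich_def T1_def)
  have "card T2 \<le> card T" using finT by (auto simp: T2_def intro: card_mono)
  then have c3: "real (card T2) \<le> c * ?n\<^sup>2" using c2 by linarith
  have "sum ?w T1 \<le> (\<Sum>B\<in>T1. 4 / ?n * ?p)"
    using passing2_le(1)[OF S A _ comp] T by (intro sum_mono) (auto simp: T1_def cube_nbrs_def)
  also have "\<dots> = real (card T1) * (4 / ?n * ?p)" by simp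
  also have "\<dots> \<le> (c * ?n) * (4 / ?n * ?p)" using c1 n by (intro mult_right_mono) auto
  also have "\<dots> = 4 * c * ?p" using n by simp
  finally have s1: "sum ?w T1 \<le> 4 * c * ?p" .
  have "sum ?w T2 \<le> (\<Sum>B\<in>T2. 64 / ?n\<^sup>2 * ?p)"
    using passing2_le(2)[OF S A _ comp] T by (intro sum_mono) (auto simp: T1_def T2_def cube_nbrs_def)
  also have "\<dots> = real (card T2) * (64 / ?n\<^sup>2 * ?p)" by simp
  also have "\<dots> \<le> (c * ?n\<^sup>2) * (64 / ?n\<^sup>2 * ?p)" using c3 n by (intro mult_right_mono) auto
  also have "\<dots> = 64 * c * ?p" using n by simp
  finally have s2: "sum ?w T2 \<le> 64 * c * ?p" .
  have "sum ?w T = sum ?w T1 + sum ?w T2"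
    using sum.subset_diff[of T1 T ?w] finT by (auto simp: T1_def T2_def add.commute)
  then show ?thesis using s1 s2 by (simp add: algebra_simps)
qed

section \<open>Finding a root\<close>

text \<open>The number of predecessors is injective on a chain, so at most \<open>a\<close> elements
  have one of the values below \<open>a\<close>.\<close>

lemma card_few_below:
  assumes C: "finite C" "\<And>A B. A \<in> C \<Longrightarrow> B \<in> C \<Longrightarrow> A \<subseteq> B \<or> B \<subseteq> A"
  shows "card {A \<in> C. card {B \<in> C. B \<subset> A} < a} \<le> a"
proof -
  let ?f = "\<lambda>A. card {B \<in> C. B \<subset> A}"
  have lt: "?f A < ?f B" if "A \<in> C" "B \<in> C" "A \<subset> B" for A B
    using that C by (intro psubset_card_mono) auto
  have "inj_on ?f {A \<in> C. ?f A < a}"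
  proof (rule inj_onI)
    fix A B assume "A \<in> {A \<in> C. ?f A < a}" "B \<in> {A \<in> C. ?f A < a}" "?f A = ?f B"
    then show "A = B" using lt[of A B] lt[of B A] C(2)[of A B] by auto
  qed
  then have "card {A \<in> C. ?f A < a} \<le> card {..<a}"
    by (intro card_inj_on_le[of ?f]) auto
  then show ?thesis by simp
qed

lemma card_few_above:
  assumes C: "finite C" "\<And>A B. A \<in> C \<Longrightarrow> B \<in> C \<Longrightarrow> A \<subseteq> B \<or> B \<subseteq> A"
  shows "card {A \<in> C. card {B \<in> C. A \<subset> B} < a} \<le> a"
proof -
  let ?f = "\<lambda>A. card {B \<in> C. A \<subset> B}"
  have lt: "?f B < ?f A" if "A \<in> C" "B \<in> C" "A \<subset> B" for A B
    using that C by (intro psubset_card_mono) auto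
  have "inj_on ?f {A \<in> C. ?f A < a}"
  proof (rule inj_onI)
    fix A B assume "A \<in> {A \<in> C. ?f A < a}" "B \<in> {A \<in> C. ?f A < a}" "?f A = ?f B"
    then show "A = B" using lt[of A B] lt[of B A] C(2)[of A B] by auto
  qed
  then have "card {A \<in> C. ?f A < a} \<le> card {..<a}"
    by (intro card_inj_on_le[of ?f]) auto
  then show ?thesis by simp
qed

text \<open>The target family \<open>T\<close> is a parameter because joints look for candidates in
  all of \<open>F\<close>, while roots look for them among the joints, so that what is placed next
  to the root can be extended further.\<close>

definition poor_above :: "real \<Rightarrow> nat \<Rightarrow> 'a set set \<Rightarrow> 'a set set" where
  "poor_above c n T = {A. \<not> rich c n A {B \<in> T. A \<subset> B}}"

definition poor_below :: "real \<Rightarrow> nat \<Rightarrow> 'a set set \<Rightarrow> 'a set set" where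
  "poor_below c n T = {A. \<not> rich c n A {B \<in> T. B \<subset> A}}"

text \<open>Here \<open>a\<close> and \<open>b\<close> are the depths of the tree poset below and above its root. A neighbour of the
  root always needs candidates on the side of the root, but candidates on the other side only if
  the depth there is two.\<close>

definition upper_joints :: "real \<Rightarrow> nat \<Rightarrow> nat \<Rightarrow> 'a set set \<Rightarrow> 'a set set" where
  "upper_joints c n b F =
    {A \<in> F. A \<notin> poor_below c n F \<and> (2 \<le> b \<longrightarrow> A \<notin> poor_above c n F)}"

definition lower_joints :: "real \<Rightarrow> nat \<Rightarrow> nat \<Rightarrow> 'a set set \<Rightarrow> 'a set set" where
  "lower_joints c n a F =
    {A \<in> F. A \<notin> poor_above c n F \<and> (2 \<le> a \<longrightarrow> A \<notin> poor_below c n F)}"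

definition roots :: "real \<Rightarrow> nat \<Rightarrow> nat \<Rightarrow> nat \<Rightarrow> 'a set set \<Rightarrow> 'a set set" where
  "roots c n a b F = {A \<in> F.
    (1 \<le> b \<longrightarrow> A \<notin> poor_above c n (upper_joints c n b F)) \<and>
    (1 \<le> a \<longrightarrow> A \<notin> poor_below c n (lower_joints c n a F))}"

text \<open>Delete from the chain the elements that are poor in a direction in which it continues (\<open>D1\<close> and
  \<open>D2\<close>). A remaining element with \<open>a\<close> elements below and \<open>b\<close> above it then sees a joint on each side
  where one is needed; as it is not a root, it lies in \<open>D3\<close> or \<open>D4\<close>.\<close>

lemma card_chain_le:
  assumes fin: "finite C" and CF: "C \<subseteq> F"
    and chain: "\<And>A B. A \<in> C \<Longrightarrow> B \<in> C \<Longrightarrow> A \<subseteq> B \<or> B \<subseteq> A"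
    and no_root: "roots c n a b F = {}"
  defines "D1 \<equiv> {A \<in> C. A \<in> poor_above c n F \<and> (\<exists>B\<in>C. A \<subset> B)}"
    and "D2 \<equiv> {A \<in> C. A \<in> poor_below c n F \<and> (\<exists>B\<in>C. B \<subset> A)}"
    and "D3 \<equiv> {A \<in> C. A \<in> poor_above c n (upper_joints c n b F) \<and>
              (\<exists>B\<in>C. B \<in> upper_joints c n b F \<and> A \<subset> B)}"
    and "D4 \<equiv> {A \<in> C. A \<in> poor_below c n (lower_joints c n a F) \<and>
              (\<exists>B\<in>C. B \<in> lower_joints c n a F \<and> B \<subset> A)}"
  shows "card C \<le> a + b + (card D1 + card D2 + card D3 + card D4)"
proof -
  define K where "K = C - D1 - D2"
  have finK: "finite K" using fin by (simp add: K_def)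
  have chK: "A \<subseteq> B \<or> B \<subseteq> A" if "A \<in> K" "B \<in> K" for A B using that chain by (auto simp: K_def)
  define lo hi where "lo = {A \<in> K. card {B \<in> K. B \<subset> A} < a}"
    and "hi = {A \<in> K. card {B \<in> K. A \<subset> B} < b}"
  have lohi: "card lo \<le> a" "card hi \<le> b"
    unfolding lo_def hi_def using card_few_below[OF finK chK] card_few_above[OF finK chK] by auto
  have up: "\<exists>B\<in>K. B \<in> upper_joints c n b F \<and> A \<subset> B" if A: "A \<in> K" "A \<notin> hi" "1 \<le> b" for A
  proof -
    define U where "U = {B \<in> K. A \<subset> B}"
    have U: "finite U" "b \<le> card U" using finK A by (auto simp: U_def hi_def)
    then have "U \<noteq> {}" using A(3) by auto
    \<comment> \<open>The successor of \<open>A\<close> in \<open>K\<close> is the joint. Having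
      \<open>A\<close> below it and being outside \<open>D2\<close>, it is not poor below; if
      \<open>2 \<le> b\<close>, another element of \<open>U\<close> lies above it, and being outside
      \<open>D1\<close> it is not poor above.\<close>
    then obtain B where B: "B \<in> U" and min: "\<And>B'. B' \<in> U \<Longrightarrow> B' \<subseteq> B \<Longrightarrow> B = B'"
      using finite_has_minimal[OF U(1)] by blast
    have "B \<notin> poor_above c n F" if "2 \<le> b"
    proof -
      have "\<not> U \<subseteq> {B}"
      proof
        assume "U \<subseteq> {B}"
        then have "card U \<le> 1" using card_mono[of "{B}" U] by simp
        then show False using that U by simp
      qed
      then obtain B' where "B' \<in> U" "B' \<noteq> B" by auto
      then have "B \<subset> B'" using min[of B'] chK[of B B'] B by (auto simp: U_def)
      then show ?thesis using B \<open>B' \<in> U\<close> by (auto simp: U_def K_def D1_def)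
    qed
    moreover have "B \<notin> poor_below c n F"
      using A(1) B by (auto simp: U_def K_def D2_def)
    ultimately show ?thesis using B CF by (auto simp: U_def K_def upper_joints_def)
  qed
  have dn: "\<exists>B\<in>K. B \<in> lower_joints c n a F \<and> B \<subset> A" if A: "A \<in> K" "A \<notin> lo" "1 \<le> a" for A
  proof -
    define U where "U = {B \<in> K. B \<subset> A}"
    have U: "finite U" "a \<le> card U" using finK A by (auto simp: U_def lo_def)
    then have "U \<noteq> {}" using A(3) by auto
    \<comment> \<open>Dually, the joint is the predecessor of \<open>A\<close> in
      \<open>K\<close>.\<close>
    then obtain B where B: "B \<in> U" and max: "\<And>B'. B' \<in> U \<Longrightarrow> B \<subseteq> B' \<Longrightarrow> B = B'"
      using finite_has_maximal[OF U(1)] by blast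
    have "B \<notin> poor_below c n F" if "2 \<le> a"
    proof -
      have "\<not> U \<subseteq> {B}"
      proof
        assume "U \<subseteq> {B}"
        then have "card U \<le> 1" using card_mono[of "{B}" U] by simp
        then show False using that U by simp
      qed
      then obtain B' where "B' \<in> U" "B' \<noteq> B" by auto
      then have "B' \<subset> B" using max[of B'] chK[of B B'] B by (auto simp: U_def)
      then show ?thesis using B \<open>B' \<in> U\<close> by (auto simp: U_def K_def D2_def)
    qed
    moreover have "B \<notin> poor_above c n F"
      using A(1) B by (auto simp: U_def K_def D1_def)
    ultimately show ?thesis using B CF by (auto simp: U_def K_def lower_joints_def)
  qed
  have "C \<subseteq> lo \<union> hi \<union> D1 \<union> D2 \<union> D3 \<union> D4"
  proof
    fix A assume A: "A \<in> C"
    show "A \<in> lo \<union> hi \<union> D1 \<union> D2 \<union> D3 \<union> D4"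
    proof (rule ccontr)
      assume n: "A \<notin> lo \<union> hi \<union> D1 \<union> D2 \<union> D3 \<union> D4"
      then have K: "A \<in> K" "A \<notin> lo" "A \<notin> hi" using A by (auto simp: K_def)
      have "A \<in> F" using A CF by auto
      then consider "1 \<le> b" "A \<in> poor_above c n (upper_joints c n b F)"
        | "1 \<le> a" "A \<in> poor_below c n (lower_joints c n a F)"
        using no_root by (auto simp: roots_def)
      then show False
      proof cases
        case 1
        then show False using up[OF K(1,3) 1(1)] n A by (auto simp: D3_def K_def)
      next
        case 2
        then show False using dn[OF K(1,2) 2(1)] n A by (auto simp: D4_def K_def)
      qed
    qed
  qed
  moreover have "finite (lo \<union> hi \<union> D1 \<union> D2 \<union> D3 \<union> D4)"
    using fin finK by (auto simp: lo_def hi_def D1_def D2_def D3_def D4_def)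
  ultimately have "card C \<le> card (lo \<union> hi \<union> D1 \<union> D2 \<union> D3 \<union> D4)" by (rule card_mono[rotated])
  also have "\<dots> \<le> card lo + card hi + card D1 + card D2 + card D3 + card D4"
    by (meson card_Un_le order_trans add_le_mono1)
  finally show ?thesis using lohi by linarith
qed

section \<open>Averaging over all maximal chains\<close>

definition trace :: "'a set set \<Rightarrow> 'a list \<Rightarrow> 'a set set" where
  "trace F xs = {A \<in> F. set (take (card A) xs) = A}"

lemma trace_chain:
  assumes "A \<in> trace F xs" "B \<in> trace F xs"
  shows "A \<subseteq> B \<or> B \<subseteq> A"
  using assms set_take_subset_set_take[of "card A" "card B" xs]
    set_take_subset_set_take[of "card B" "card A" xs]
  by (auto simp: trace_def) (metis le_cases subsetD)+

text \<open>Double counting of the incidences between members of \<open>F\<close> and maximal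
  chains.\<close>

lemma sum_card_trace:
  assumes "finite F"
  shows "(\<Sum>xs\<in>permutations_of_set S. card (trace F xs)) = (\<Sum>A\<in>F. card (passing S A))"
  unfolding trace_def passing_def using assms by (intro sum_multicount_gen) auto

text \<open>A union bound: each counted \<open>A\<close> is charged to a pair \<open>(A, B)\<close>
  lying on the same chain, and for fixed poor \<open>A\<close> the pairs are bounded by
  \<open>poor_passing_le\<close>. With \<open>R\<close> as inclusion or its converse, and
  \<open>G\<close> as \<open>F\<close> or a family of joints, this covers \<open>D1\<close> to
  \<open>D4\<close>.\<close>

lemma sum_poor_le:
  assumes S: "finite S" "8 \<le> card S" and F: "F \<subseteq> central S" and G: "G \<subseteq> F"
    and R: "\<And>A B. R A B \<Longrightarrow> A \<subset> B \<or> B \<subset> A" and c: "0 \<le> c"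
  defines "Q \<equiv> {A. \<not> rich c (card S) A {B \<in> G. R A B}}"
  shows "(\<Sum>xs\<in>permutations_of_set S.
      real (card {A \<in> trace F xs. A \<in> Q \<and> (\<exists>B\<in>trace F xs. B \<in> G \<and> R A B)}))
    \<le> 68 * c * (\<Sum>xs\<in>permutations_of_set S. real (card (trace F xs)))"
proof -
  let ?P = "permutations_of_set S"
  let ?w = "\<lambda>A B. real (card (passing S A \<inter> passing S B))"
  have finF: "finite F" using F S by (auto simp: central_def intro: finite_subset[of F "Pow S"])
  then have finG: "finite G" using G by (rule finite_subset[rotated])
  have "(\<Sum>xs\<in>?P. real (card {A \<in> trace F xs. A \<in> Q \<and> (\<exists>B\<in>trace F xs. B \<in> G \<and> R A B)}))
    \<le> (\<Sum>xs\<in>?P. real (card {p \<in> Sigma (F \<inter> Q) (\<lambda>A. {B \<in> G. R A B}).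
          xs \<in> passing S (fst p) \<inter> passing S (snd p)}))"
  proof (intro sum_mono of_nat_mono)
    fix xs assume xs: "xs \<in> ?P"
    show "card {A \<in> trace F xs. A \<in> Q \<and> (\<exists>B\<in>trace F xs. B \<in> G \<and> R A B)} \<le>
      card {p \<in> Sigma (F \<inter> Q) (\<lambda>A. {B \<in> G. R A B}). xs \<in> passing S (fst p) \<inter> passing S (snd p)}"
      using finF finG xs
      \<comment> \<open>The first projection maps the pairs on the chain onto the counted
        elements.\<close>
      by (intro surj_card_le[where f = fst] finite_subset[OF _ finite_cartesian_product[OF finF finG]])
        (force simp: trace_def passing_def)+
  qed
  also have "\<dots> = real (\<Sum>p\<in>Sigma (F \<inter> Q) (\<lambda>A. {B \<in> G. R A B}).
      card (passing S (fst p) \<inter> passing S (snd p)))"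
    unfolding of_nat_sum[symmetric]
  proof (intro arg_cong[where f = real] sum_multicount_gen)
    show "\<forall>p\<in>Sigma (F \<inter> Q) (\<lambda>A. {B \<in> G. R A B}).
      card {xs \<in> ?P. xs \<in> passing S (fst p) \<inter> passing S (snd p)} =
      card (passing S (fst p) \<inter> passing S (snd p))"
      by (intro ballI arg_cong[where f = card]) (auto simp: passing_def)
  qed (use finF finG in auto)
  also have "\<dots> = (\<Sum>A\<in>F \<inter> Q. \<Sum>B\<in>{B \<in> G. R A B}. ?w A B)"
    using finF finG by (subst sum.Sigma) (auto simp: case_prod_beta)
  also have "\<dots> \<le> (\<Sum>A\<in>F \<inter> Q. 68 * c * card (passing S A))"
  proof (intro sum_mono)
    fix A assume "A \<in> F \<inter> Q"
    then show "(\<Sum>B\<in>{B \<in> G. R A B}. ?w A B) \<le> 68 * c * card (passing S A)"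
      using F G R by (intro poor_passing_le[OF S]) (auto simp: Q_def)
  qed
  also have "\<dots> \<le> (\<Sum>A\<in>F. 68 * c * card (passing S A))"
    using finF c by (intro sum_mono2) auto
  also have "\<dots> = 68 * c * (\<Sum>xs\<in>?P. real (card (trace F xs)))"
    unfolding sum_distrib_left[symmetric] of_nat_sum[symmetric] sum_card_trace[OF finF] by simp
  finally show ?thesis .
qed

text \<open>The LYM estimate: a set lies on \<open>n!\<close> divided by a binomial coefficient many
  chains, and the middle coefficient is the largest.\<close>

lemma sum_card_trace_ge:
  assumes S: "finite S" and F: "F \<subseteq> Pow S"
  shows "real (card F) * fact (card S) / real (card S choose (card S div 2))
    \<le> (\<Sum>xs\<in>permutations_of_set S. real (card (trace F xs)))"
proof -
  have finF: "finite F" using F S by (auto intro: finite_subset)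
  have "real (card F) * fact (card S) / real (card S choose (card S div 2)) =
    (\<Sum>A\<in>F. fact (card S) / real (card S choose (card S div 2)))" by simp
  also have "\<dots> \<le> (\<Sum>A\<in>F. real (card (passing S A)))"
  proof (intro sum_mono)
    fix A assume "A \<in> F"
    then have A: "A \<subseteq> S" using F by auto
    then have "0 < card S choose card A" using S by (simp add: card_mono)
    moreover have "card S choose card A \<le> card S choose (card S div 2)" by (rule binomial_maximum)
    ultimately show "fact (card S) / real (card S choose (card S div 2)) \<le> real (card (passing S A))"
      unfolding card_passing_binomial[OF S A] by (intro divide_left_mono) auto
  qed
  also have "\<dots> = (\<Sum>xs\<in>permutations_of_set S. real (card (trace F xs)))"
    unfolding of_nat_sum[symmetric] sum_card_trace[OF finF] ..
  finally show ?thesis .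
qed

text \<open>Without roots, \<open>card_chain_le\<close> summed over all chains gives
  \<open>L \<le> (a + b) * n! + 272 * c * L\<close>, where 272 = 4 * 68 accounts for
  \<open>D1\<close> to \<open>D4\<close>. For small \<open>c\<close> this contradicts
  \<open>L \<ge> (a + b + e) * n!\<close>.\<close>

lemma roots_nonempty:
  assumes S: "finite S" "8 \<le> card S" and F: "F \<subseteq> central S" and e: "0 < e" and c: "0 \<le> c"
    and large: "(real (a + b) + e) * real (card S choose (card S div 2)) \<le> real (card F)"
    and c_small: "272 * c * (real (a + b) + e) < e"
  shows "roots c (card S) a b F \<noteq> {}"
proof
  assume no_root: "roots c (card S) a b F = {}"
  let ?P = "permutations_of_set S" and ?n = "card S"
  have finF: "finite F" using F S by (auto simp: central_def intro: finite_subset[of F "Pow S"])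
  define L where "L = (\<Sum>xs\<in>?P. real (card (trace F xs)))"
  define s where "s = real (a + b)"
  define U D where "U = upper_joints c ?n b F" and "D = lower_joints c ?n a F"
  define D1 where "D1 xs = {A \<in> trace F xs. A \<in> poor_above c ?n F \<and> (\<exists>B\<in>trace F xs. A \<subset> B)}" for xs
  define D2 where "D2 xs = {A \<in> trace F xs. A \<in> poor_below c ?n F \<and> (\<exists>B\<in>trace F xs. B \<subset> A)}" for xs
  define D3 where "D3 xs = {A \<in> trace F xs. A \<in> poor_above c ?n U \<and> (\<exists>B\<in>trace F xs. B \<in> U \<and> A \<subset> B)}" for xs
  define D4 where "D4 xs = {A \<in> trace F xs. A \<in> poor_below c ?n D \<and> (\<exists>B\<in>trace F xs. B \<in> D \<and> B \<subset> A)}" for xs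
  \<comment> \<open>This form is the one that \<open>sum_poor_le\<close> takes for
    \<open>G = F\<close>.\<close>
  have D1': "D1 xs = {A \<in> trace F xs. A \<in> poor_above c ?n F \<and> (\<exists>B\<in>trace F xs. B \<in> F \<and> A \<subset> B)}"
    and D2': "D2 xs = {A \<in> trace F xs. A \<in> poor_below c ?n F \<and> (\<exists>B\<in>trace F xs. B \<in> F \<and> B \<subset> A)}" for xs
    by (auto simp: D1_def D2_def trace_def)
  have UD: "U \<subseteq> F" "D \<subseteq> F" by (auto simp: U_def D_def upper_joints_def lower_joints_def)
  have b1: "(\<Sum>xs\<in>?P. real (card (D1 xs))) \<le> 68 * c * L"
    unfolding D1' poor_above_def L_def by (rule sum_poor_le[OF S F]) (use c in auto)
  have b2: "(\<Sum>xs\<in>?P. real (card (D2 xs))) \<le> 68 * c * L"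
    unfolding D2' poor_below_def L_def by (rule sum_poor_le[OF S F]) (use c in auto)
  have b3: "(\<Sum>xs\<in>?P. real (card (D3 xs))) \<le> 68 * c * L"
    unfolding D3_def poor_above_def L_def by (rule sum_poor_le[OF S F UD(1)]) (use c in auto)
  have b4: "(\<Sum>xs\<in>?P. real (card (D4 xs))) \<le> 68 * c * L"
    unfolding D4_def poor_below_def L_def by (rule sum_poor_le[OF S F UD(2)]) (use c in auto)
  have "L \<le> (\<Sum>xs\<in>?P. s + (real (card (D1 xs)) + real (card (D2 xs)) + real (card (D3 xs)) + real (card (D4 xs))))"
    unfolding L_def
  proof (intro sum_mono)
    fix xs
    have "card (trace F xs) \<le> a + b + (card (D1 xs) + card (D2 xs) + card (D3 xs) + card (D4 xs))"
      unfolding D1_def D2_def D3_def D4_def U_def D_def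
      by (rule card_chain_le[OF _ _ trace_chain no_root]) (use finF in \<open>auto simp: trace_def\<close>)
    then have "real (card (trace F xs)) \<le> real (a + b + (card (D1 xs) + card (D2 xs) + card (D3 xs) + card (D4 xs)))"
      by (rule of_nat_mono)
    then show "real (card (trace F xs)) \<le>
      s + (real (card (D1 xs)) + real (card (D2 xs)) + real (card (D3 xs)) + real (card (D4 xs)))"
      by (simp add: s_def)
  qed
  then have le: "L \<le> s * fact ?n + 272 * c * L"
  proof -
    note \<open>L \<le> _\<close>
    also have "(\<Sum>xs\<in>?P. s + (real (card (D1 xs)) + real (card (D2 xs)) + real (card (D3 xs)) + real (card (D4 xs)))) =
      s * fact ?n + ((\<Sum>xs\<in>?P. real (card (D1 xs))) + (\<Sum>xs\<in>?P. real (card (D2 xs))) +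
        (\<Sum>xs\<in>?P. real (card (D3 xs))) + (\<Sum>xs\<in>?P. real (card (D4 xs))))"
      using S by (simp add: sum.distrib)
    finally show ?thesis using b1 b2 b3 b4 by linarith
  qed
  have "0 < ?n choose (?n div 2)" by simp
  then have "(s + e) * fact ?n \<le> real (card F) * fact ?n / real (?n choose (?n div 2))"
    using large by (simp add: s_def pos_le_divide_eq mult.commute mult.left_commute)
  also have "\<dots> \<le> L"
    unfolding L_def using F by (intro sum_card_trace_ge S) (auto simp: central_def)
  finally have ge: "(s + e) * fact ?n \<le> L" .
  have s0: "0 \<le> s" by (simp add: s_def)
  have k: "272 * c * (s + e) < e" using c_small by (simp add: s_def)
  have "272 * c * (s + e) < 1 * (s + e)" by (rule less_le_trans[OF k]) (use s0 in simp)
  \<comment> \<open>Positivity of \<open>1 - 272 * c\<close> allows the lower bound on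
    \<open>L\<close> to be multiplied by it.\<close>
  then have k1: "272 * c < 1" using s0 e by (simp only: mult_less_cancel_right)
  have "((s + e) * fact ?n) * (1 - 272 * c) \<le> L * (1 - 272 * c)"
    using ge k1 by (intro mult_right_mono) auto
  also have "\<dots> \<le> s * fact ?n" using le by (simp add: algebra_simps)
  finally have "((s + e) * (1 - 272 * c)) * fact ?n \<le> s * fact ?n" by (simp only: mult_ac)
  then have "(s + e) * (1 - 272 * c) \<le> s" by (simp add: mult_le_cancel_right)
  then show False using k by (simp add: algebra_simps)
qed

section \<open>Negligibility of the non-central sets\<close>

text \<open>Expand the product of the factors \<open>1/2 + 1\<close> over \<open>S\<close>.\<close>

lemma sum_half_power_card_Pow:
  assumes "finite S"
  shows "(\<Sum>A\<in>Pow S. (1 / 2 :: real) ^ card A) = (3 / 2) ^ card S"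
proof -
  have "(\<Sum>A\<in>Pow S. (1 / 2 :: real) ^ card A) = (\<Sum>A\<in>Pow S. (\<Prod>x\<in>A. 1 / 2) * (\<Prod>x\<in>S - A. 1))"
    by simp
  also have "\<dots> = (\<Prod>x\<in>S. (1 / 2 :: real) + 1)"
    using prod_add[OF assms, of "\<lambda>_. 1 / 2 :: real" "\<lambda>_. 1"] by simp
  finally show ?thesis by simp
qed

text \<open>An exponential Markov bound. As \<open>(5/4)^4 > 2\<close>, every counted
  \<open>A\<close> has weight \<open>(1/2)^|A| * (5/4)^n\<close> at least 1, and the total weight is
  \<open>(3/2 * 5/4)^n\<close>, whose base 15/8 is below 2.\<close>

lemma card_small_subsets_le:
  assumes S: "finite S"
  shows "real (card {A \<in> Pow S. 4 * card A < card S}) \<le> (15 / 8) ^ card S"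
proof -
  let ?T = "{A \<in> Pow S. 4 * card A < card S}"
  have "real (card ?T) = (\<Sum>A\<in>?T. 1)" by simp
  also have "\<dots> \<le> (\<Sum>A\<in>?T. (1 / 2) ^ card A * (5 / 4) ^ card S)"
  proof (intro sum_mono)
    fix A assume "A \<in> ?T"
    have "(2::real) ^ card A \<le> ((5 / 4) ^ 4) ^ card A"
      by (intro power_mono) (auto simp: power4_eq_xxxx)
    also have "\<dots> = (5 / 4) ^ (4 * card A)" by (simp only: power_mult)
    also have "\<dots> \<le> (5 / 4) ^ card S" using \<open>A \<in> ?T\<close> by (intro power_increasing) auto
    finally show "1 \<le> (1 / 2) ^ card A * (5 / 4 :: real) ^ card S"
      by (simp add: power_one_over field_simps)
  qed
  also have "\<dots> \<le> (\<Sum>A\<in>Pow S. (1 / 2) ^ card A * (5 / 4) ^ card S)"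
    using S by (intro sum_mono2) auto
  also have "\<dots> = (3 / 2) ^ card S * (5 / 4) ^ card S"
    unfolding sum_distrib_right[symmetric] sum_half_power_card_Pow[OF S] ..
  also have "\<dots> = (15 / 8) ^ card S" by (simp flip: power_mult_distrib)
  finally show ?thesis .
qed

text \<open>Complementation turns the sets that are too large into sets that are too small.\<close>

lemma card_noncentral_le:
  assumes S: "finite S"
  shows "real (card (Pow S - central S)) \<le> 2 * (15 / 8) ^ card S"
proof -
  let ?T = "{A \<in> Pow S. 4 * card A < card S}"
  have "Pow S - central S \<subseteq> ?T \<union> (\<lambda>A. S - A) ` ?T"
  proof
    fix A assume A: "A \<in> Pow S - central S"
    then have "A \<subseteq> S" and sz: "4 * card A < card S \<or> 3 * card S < 4 * card A"
      by (auto simp: central_def)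
    show "A \<in> ?T \<union> (\<lambda>A. S - A) ` ?T"
    proof (cases "4 * card A < card S")
      case False
      have "card (S - A) = card S - card A"
        using S \<open>A \<subseteq> S\<close> by (simp add: card_Diff_subset finite_subset)
      moreover have "card A \<le> card S" using S \<open>A \<subseteq> S\<close> by (simp add: card_mono)
      ultimately have "S - A \<in> ?T" using sz False by auto
      moreover have "A = S - (S - A)" using \<open>A \<subseteq> S\<close> by auto
      ultimately show ?thesis by blast
    qed (use \<open>A \<subseteq> S\<close> in auto)
  qed
  then have "card (Pow S - central S) \<le> card (?T \<union> (\<lambda>A. S - A) ` ?T)"
    using S by (intro card_mono) auto
  also have "\<dots> \<le> card ?T + card ((\<lambda>A. S - A) ` ?T)" by (rule card_Un_le)
  also have "\<dots> \<le> card ?T + card ?T" using S by (intro add_left_mono card_image_le) auto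
  finally have "real (card (Pow S - central S)) \<le> 2 * real (card ?T)" by linarith
  then show ?thesis using card_small_subsets_le[OF S] by linarith
qed

lemma two_power_le_middle_binomial: "2 ^ n \<le> (n + 1) * (n choose (n div 2))"
proof -
  have "2 ^ n = (\<Sum>k\<le>n. n choose k)" by (simp add: choose_row_sum)
  also have "\<dots> \<le> (\<Sum>k\<le>n. n choose (n div 2))" by (intro sum_mono binomial_maximum)
  finally show ?thesis by simp
qed

text \<open>Since \<open>2^n\<close> is at most \<open>n + 1\<close> times the middle coefficient,
  the proportion is at most \<open>2 * (n + 1) * (15/16)^n\<close>, which tends to 0.\<close>

lemma noncentral_negligible:
  assumes "0 < e"
  shows "\<forall>\<^sub>F n in sequentially. \<forall>S :: 'a set. finite S \<and> card S = n \<longrightarrow>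
    real (card (Pow S - central S)) \<le> e * real (n choose (n div 2))"
proof -
  have "(\<lambda>n. 2 * (real n * (15 / 16) ^ n + (15 / 16) ^ n)) \<longlonglongrightarrow> 2 * (0 + 0)"
    by (intro tendsto_intros powser_times_n_limit_0 LIMSEQ_power_zero) auto
  then have "\<forall>\<^sub>F n in sequentially. 2 * (real n * (15 / 16) ^ n + (15 / 16) ^ n) < e"
    using assms by (intro order_tendstoD) auto
  then show ?thesis
  proof eventually_elim
    case (elim n)
    show ?case
    proof (intro allI impI)
      fix S :: "'a set" assume S: "finite S \<and> card S = n"
      have m: "(2::real) ^ n \<le> (real n + 1) * real (n choose (n div 2))"
        using of_nat_mono[OF two_power_le_middle_binomial[of n], where ?'a = real] by (simp add: algebra_simps)
      have "real (card (Pow S - central S)) \<le> 2 * (15 / 8) ^ n"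
        using card_noncentral_le[of S] S by simp
      also have "\<dots> = 2 * (15 / 16) ^ n * 2 ^ n" by (simp flip: power_mult_distrib)
      also have "\<dots> \<le> 2 * (15 / 16) ^ n * ((real n + 1) * real (n choose (n div 2)))"
        by (intro mult_left_mono m) auto
      also have "\<dots> = 2 * (real n * (15 / 16) ^ n + (15 / 16) ^ n) * real (n choose (n div 2))"
        by (simp add: algebra_simps)
      also have "\<dots> \<le> e * real (n choose (n div 2))"
        using elim by (intro mult_right_mono) auto
      finally show "real (card (Pow S - central S)) \<le> e * real (n choose (n div 2))" .
    qed
  qed
qed

section \<open>Embedding the blow-up\<close>

lemma sym_diff_card_1:
  assumes "card (sym_diff A B) = 1"
  obtains f where "\<And>x. x \<in> B \<longleftrightarrow> (x \<in> A) \<noteq> (x = f)"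
proof -
  obtain f where "sym_diff A B = {f}" using assms by (rule card_1_singletonE)
  then have "x \<in> B \<longleftrightarrow> (x \<in> A) \<noteq> (x = f)" for x by (auto simp: set_eq_iff)
  then show ?thesis by (rule that)
qed

text \<open>If toggling \<open>f\<close> in \<open>A\<close> and \<open>f'\<close> in
  \<open>A'\<close> gives the same set, then \<open>A\<close> and \<open>A'\<close> differ exactly
  in \<open>f\<close> and \<open>f'\<close>, so every common neighbour arises from \<open>A\<close>
  by toggling one of these two. Finiteness is recorded separately because an infinite set has
  \<open>card\<close> 0.\<close>

lemma card_common_nbrs_le:
  assumes "A \<noteq> A'"
  shows "card (cube_nbrs A \<inter> cube_nbrs A') \<le> 2"
    and "finite (cube_nbrs A \<inter> cube_nbrs A')"
proof -
  let ?N = "cube_nbrs A \<inter> cube_nbrs A'"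
  have "\<exists>D. ?N \<subseteq> D \<and> finite D \<and> card D \<le> 2"
  proof (cases "?N = {}")
    case True
    then show ?thesis by (intro exI[of _ "{}"]) simp
  next
    case False
    then obtain B where "card (sym_diff A B) = 1" "card (sym_diff A' B) = 1" unfolding cube_nbrs_def by blast
    then obtain f f' where f: "\<And>x. x \<in> B \<longleftrightarrow> (x \<in> A) \<noteq> (x = f)" "\<And>x. x \<in> B \<longleftrightarrow> (x \<in> A') \<noteq> (x = f')"
      by (metis sym_diff_card_1)
    have "?N \<subseteq> (\<lambda>h. {x. (x \<in> A) \<noteq> (x = h)}) ` {f, f'}"
    proof
      fix B assume "B \<in> ?N"
      then have "card (sym_diff A B) = 1" "card (sym_diff A' B) = 1" by (simp_all add: cube_nbrs_def)
      then obtain h h' where h: "\<And>x. x \<in> B \<longleftrightarrow> (x \<in> A) \<noteq> (x = h)" "\<And>x. x \<in> B \<longleftrightarrow> (x \<in> A') \<noteq> (x = h')"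
        by (metis sym_diff_card_1)
      have "h \<noteq> h'"
      proof
        assume "h = h'"
        then have "x \<in> A \<longleftrightarrow> x \<in> A'" for x using h[of x] by blast
        then show False using assms by blast
      qed
      then have "h \<in> {f, f'}" using h[of h] f[of h] by blast
      moreover have "B = {x. (x \<in> A) \<noteq> (x = h)}" using h(1) by blast
      ultimately show "B \<in> (\<lambda>h. {x. (x \<in> A) \<noteq> (x = h)}) ` {f, f'}" by (rule rev_image_eqI)
    qed
    moreover have "card ((\<lambda>h. {x. (x \<in> A) \<noteq> (x = h)}) ` {f, f'}) \<le> 2"
      by (rule order_trans[OF card_image_le]) (auto simp: card_insert_if)
    ultimately show ?thesis by (intro exI conjI) auto
  qed
  then obtain D where D: "?N \<subseteq> D" "finite D" "card D \<le> 2" by blast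
  show "card ?N \<le> 2" using card_mono[OF D(2,1)] D(3) by linarith
  show "finite ?N" using D(1,2) by (rule finite_subset)
qed

text \<open>The hypothesis tells that earlier choices respect their own candidate sets. This allows
  an application to bound how many of them can fall into \<open>C i\<close>, instead of counting
  them all.\<close>

lemma greedy_selection:
  assumes "finite I"
    and "\<And>i J g. i \<in> I \<Longrightarrow> J \<subseteq> I \<Longrightarrow> (\<And>j. j \<in> J \<Longrightarrow> g j \<in> C j) \<Longrightarrow> \<exists>z\<in>C i. z \<notin> g ` J"
  shows "\<exists>g. inj_on g I \<and> (\<forall>i\<in>I. g i \<in> C i)"
  using assms
proof (induction I)
  case empty
  then show ?case by simp
next
  case (insert i I)
  have "\<exists>g. inj_on g I \<and> (\<forall>i\<in>I. g i \<in> C i)"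
    using insert.prems by (intro insert.IH) blast
  then obtain g where g: "inj_on g I" "\<And>j. j \<in> I \<Longrightarrow> g j \<in> C j" by blast
  obtain z where z: "z \<in> C i" "z \<notin> g ` I"
    using insert.prems[of i I g] g by blast
  have "inj_on (g(i := z)) (insert i I)" "\<forall>j\<in>insert i I. (g(i := z)) j \<in> C j"
    using g z insert.hyps by (auto simp: inj_on_def)
  then show ?case by blast
qed

section \<open>Distances and parents in the Hasse diagram\<close>

lemma hasse_adj_in: "(A, B) \<in> hasse_adj P \<Longrightarrow> A \<in> P \<and> B \<in> P"
  by (auto simp: hasse_adj_def hasse_edge_def)

lemma hasse_adj_iff_uedge: "(A, B) \<in> hasse_adj P \<longleftrightarrow> {A, B} \<in> hasse_uedges P"
  by (auto simp: hasse_adj_def hasse_uedges_def doubleton_eq_iff)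

lemma hdist_le: "(A, B) \<in> hasse_adj P ^^ k \<Longrightarrow> hdist P A B \<le> k"
  unfolding hdist_def by (rule Least_le)

lemma hdist_self [simp]: "hdist P A A = 0"
  using hdist_le[where k = 0] by fastforce

lemma hdist_relpow: "(A, B) \<in> (hasse_adj P)\<^sup>* \<Longrightarrow> (A, B) \<in> hasse_adj P ^^ hdist P A B"
  unfolding hdist_def by (metis LeastI rtrancl_power)

lemma hdist_eq_0D: "(A, B) \<in> (hasse_adj P)\<^sup>* \<Longrightarrow> hdist P A B = 0 \<Longrightarrow> B = A"
  using hdist_relpow[of A B P] by simp

text \<open>Take the last vertex but one of a shortest walk; a shorter way to it would shorten the
  whole walk.\<close>

lemma hdist_SucE:
  assumes "(A, B) \<in> (hasse_adj P)\<^sup>*" "hdist P A B = Suc k"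
  obtains B' where "(B', B) \<in> hasse_adj P" "hdist P A B' = k"
proof -
  have "(A, B) \<in> hasse_adj P ^^ Suc k" using hdist_relpow[OF assms(1)] assms(2) by simp
  then obtain B' where B': "(A, B') \<in> hasse_adj P ^^ k" "(B', B) \<in> hasse_adj P" by auto
  have "(A, B') \<in> (hasse_adj P)\<^sup>*" using B'(1) by (rule relpow_imp_rtrancl)
  then have "(A, B) \<in> hasse_adj P ^^ Suc (hdist P A B')"
    using hdist_relpow B'(2) by (auto intro: relpow_Suc_I)
  then have "Suc k \<le> Suc (hdist P A B')" using hdist_le assms(2) by metis
  moreover have "hdist P A B' \<le> k" using B'(1) by (rule hdist_le)
  ultimately show ?thesis using that B'(2) by auto
qed

text \<open>Sending each vertex other than the root to the edge towards a parent is injective; as a tree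
  has exactly \<open>card P - 1\<close> edges, every edge arises in this way.\<close>

lemma tree_parent_unique:
  assumes P: "tree_poset P" "x \<in> P"
    and v: "(v, u) \<in> hasse_adj P" "hdist P x u = Suc (hdist P x v)"
    and v': "(v', u) \<in> hasse_adj P" "hdist P x u = Suc (hdist P x v')"
  shows "v = v'"
proof -
  have fin: "finite P" and conn: "\<And>t. t \<in> P \<Longrightarrow> (x, t) \<in> (hasse_adj P)\<^sup>*"
    and edges: "card (hasse_uedges P) = card P - 1"
    using P by (auto simp: tree_poset_def is_poset_def)
  have "\<exists>s. (s, t) \<in> hasse_adj P \<and> hdist P x t = Suc (hdist P x s)" if "t \<in> P - {x}" for t
  proof -
    have "hdist P x t \<noteq> 0" using that hdist_eq_0D[OF conn, of t] by auto
    then obtain k where "hdist P x t = Suc k" by (cases "hdist P x t") auto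
    then show ?thesis using hdist_SucE[OF conn, of t k] that by auto
  qed
  then obtain par where par: "\<And>t. t \<in> P - {x} \<Longrightarrow> (par t, t) \<in> hasse_adj P"
    "\<And>t. t \<in> P - {x} \<Longrightarrow> hdist P x t = Suc (hdist P x (par t))" by metis
  let ?e = "\<lambda>t. {par t, t}"
  \<comment> \<open>Two vertices with the same parent edge would be parents of each other, which
    their distances from \<open>x\<close> forbid.\<close>
  have "inj_on ?e (P - {x})"
  proof (rule inj_onI, rule ccontr)
    fix s t assume st: "s \<in> P - {x}" "t \<in> P - {x}" "?e s = ?e t" "s \<noteq> t"
    then have "par s = t \<and> par t = s" unfolding doubleton_eq_iff by blast
    then show False using par(2)[OF st(1)] par(2)[OF st(2)] by simp
  qed
  moreover have "?e ` (P - {x}) \<subseteq> hasse_uedges P"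
    using par(1) by (auto simp: hasse_adj_iff_uedge)
  moreover have "finite (hasse_uedges P)"
    using fin by (auto simp: hasse_uedges_def hasse_edge_def intro: finite_subset[of _ "Pow P"])
  moreover have "card (P - {x}) = card P - 1" using P(2) fin by simp
  ultimately have img: "?e ` (P - {x}) = hasse_uedges P"
    by (intro card_subset_eq) (simp_all only: card_image edges)
  \<comment> \<open>The edge between \<open>w\<close> and \<open>u\<close> is the parent edge of
    \<open>u\<close> or of \<open>w\<close>; the latter would make \<open>u\<close> closer to
    \<open>x\<close> than \<open>w\<close>.\<close>
  have "w = par u" if w: "(w, u) \<in> hasse_adj P" "hdist P x u = Suc (hdist P x w)" for w
  proof -
    have "{w, u} \<in> ?e ` (P - {x})" using w(1) unfolding hasse_adj_iff_uedge img .
    then obtain t where t: "{w, u} = {par t, t}" "t \<in> P - {x}" by (rule imageE)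
    from t(1) have "w = par t \<and> u = t \<or> w = t \<and> u = par t" unfolding doubleton_eq_iff .
    then show ?thesis using par(2)[OF t(2)] w(2) by auto
  qed
  from this[OF v] this[OF v'] show ?thesis by simp
qed

section \<open>Placing the blow-up around a root\<close>

lemma inj_on_UnI: "inj_on f A \<Longrightarrow> inj_on f B \<Longrightarrow> f ` A \<inter> f ` B = {} \<Longrightarrow> inj_on f (A \<union> B)"
  by (auto simp: inj_on_Un)

text \<open>Here plain counting is enough: the forbidden set \<open>U\<close> and the earlier
  choices never exhaust \<open>C i\<close>.\<close>

lemma greedy_selection_large:
  assumes I: "finite I" and J: "finite U"
    and large: "\<And>i. i \<in> I \<Longrightarrow> card U + card I < card (C i)"
  shows "\<exists>g. inj_on g I \<and> (\<forall>i\<in>I. g i \<in> C i - U)"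
proof (rule greedy_selection[OF I])
  fix i J and g :: "'a \<Rightarrow> 'b"
  assume i: "i \<in> I" "J \<subseteq> I"
  have "card (U \<union> g ` J) \<le> card U + card I"
    using card_Un_le[of U "g ` J"] card_image_le[of J g] card_mono[OF I i(2)] finite_subset[OF i(2) I]
    by linarith
  moreover have "finite (U \<union> g ` J)" using J finite_subset[OF i(2) I] by simp
  ultimately have "\<not> C i \<subseteq> U \<union> g ` J"
    using large[OF i(1)] card_mono[of "U \<union> g ` J" "C i"] by linarith
  then show "\<exists>z\<in>C i - U. z \<notin> g ` J" by auto
qed

text \<open>The first level has only linearly many elements, so either alternative of richness
  suffices for it.\<close>

lemma rich_imp_card_ge:
  assumes "rich c n A T" "finite T" "0 \<le> c" "1 \<le> n"
  shows "c * real n \<le> real (card T)"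
  using assms(1) unfolding rich_def
proof
  assume "c * real n \<le> real (card (T \<inter> cube_nbrs A))"
  also have "\<dots> \<le> real (card T)" using assms by (intro of_nat_mono card_mono) auto
  finally show ?thesis .
next
  assume "c * (real n)\<^sup>2 \<le> real (card T)"
  moreover have "c * real n \<le> c * (real n)\<^sup>2"
    using assms by (intro mult_left_mono) (auto simp: power2_eq_square)
  ultimately show ?thesis by linarith
qed

text \<open>Parents with many candidates at Hamming distance one are served first: two different
  vertices of the cube have at most two common neighbours, so these parents hardly compete. All
  the other parents have quadratically many candidates, more than the blow-up has elements.\<close>

lemma contains_blowup_of_root:
  fixes P :: "'a set set" and F :: "nat set set"
  assumes P: "tree_poset P" "x \<in> P" and dist: "\<forall>u\<in>P. hdist P x u \<le> 2"
    and F: "finite F" and c: "0 \<le> c" and n: "1 \<le> n" and X: "X \<in> roots c n a b F"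
    and b1: "\<And>u. hasse_edge P x u \<Longrightarrow> 1 \<le> b"
    and b2: "\<And>u v. hasse_edge P x u \<Longrightarrow> hasse_edge P u v \<Longrightarrow> 2 \<le> b"
    and a1: "\<And>u. hasse_edge P u x \<Longrightarrow> 1 \<le> a"
    and a2: "\<And>u v. hasse_edge P u x \<Longrightarrow> hasse_edge P v u \<Longrightarrow> 2 \<le> a"
    and d1: "1 + 4 * (real (card P) * real d) < c * real n"
    and d2: "1 + real (card P) * real d + real (card P) * (real d)\<^sup>2 < c * (real n)\<^sup>2"
  shows "contains_blowup F P x d"
proof -
  let ?p = "card P"
  have finP: "finite P" and conn: "\<And>t. t \<in> P \<Longrightarrow> (x, t) \<in> (hasse_adj P)\<^sup>*"
    using P by (auto simp: tree_poset_def is_poset_def)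
  define V1 V2 where "V1 = {(u, i). u \<in> P \<and> hdist P x u = 1 \<and> i < d}"
    and "V2 = {(u, i). u \<in> P \<and> hdist P x u = 2 \<and> i < d * d}"
  have V1_sub: "V1 \<subseteq> P \<times> {..<d}" and V2_sub: "V2 \<subseteq> P \<times> {..<d * d}"
    by (auto simp: V1_def V2_def)
  have fin1: "finite V1" by (rule finite_subset[OF V1_sub]) (use finP in simp)
  have fin2: "finite V2" by (rule finite_subset[OF V2_sub]) (use finP in simp)
  have card1: "card V1 \<le> ?p * d"
    using card_mono[OF _ V1_sub] finP by (simp add: card_cartesian_product)
  have card2: "card V2 \<le> ?p * (d * d)"
    using card_mono[OF _ V2_sub] finP by (simp add: card_cartesian_product)
  have d1': "real (1 + 4 * (?p * d)) < c * real n" using d1 by simp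
  have d2': "real (1 + ?p * d + ?p * (d * d)) < c * (real n)\<^sup>2"
    using d2 by (simp add: power2_eq_square algebra_simps)

  define Up Dn where "Up = upper_joints c n b F" and "Dn = lower_joints c n a F"
  have sub: "Up \<subseteq> F" "Dn \<subseteq> F" by (auto simp: Up_def Dn_def upper_joints_def lower_joints_def)
  have adj1: "hasse_edge P x u \<or> hasse_edge P u x" if u: "u \<in> P" "hdist P x u = 1" for u
  proof -
    obtain v where v: "(v, u) \<in> hasse_adj P" "hdist P x v = 0"
      using hdist_SucE[OF conn[OF u(1)], of 0] u(2) by auto
    then have "v = x" using hdist_eq_0D[OF conn] hasse_adj_in by blast
    then show ?thesis using v by (auto simp: hasse_adj_def)
  qed
  define C1 where "C1 q = (if hasse_edge P x (fst q) then {B \<in> Up. X \<subset> B} else {B \<in> Dn. B \<subset> X})"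
    for q :: "'a set \<times> nat"
  \<comment> \<open>Nothing has to be forbidden on the first level: candidates are strictly above or
    below \<open>X\<close>, hence different from it.\<close>
  have "card {} + card V1 < card (C1 q)" if q: "q \<in> V1" for q
  proof -
    obtain u i where ui: "q = (u, i)" "u \<in> P" "hdist P x u = 1"
      using q by (auto simp: V1_def)
    have "rich c n X (C1 q)"
      using adj1[OF ui(2,3)] b1[of u] a1[of u] X
      by (auto simp: C1_def ui(1) roots_def poor_above_def poor_below_def Up_def Dn_def)
    moreover have "finite (C1 q)" using finite_subset[OF sub(1) F] finite_subset[OF sub(2) F] by (simp add: C1_def)
    ultimately have "c * real n \<le> real (card (C1 q))" using c n by (intro rich_imp_card_ge)
    then have "1 + 4 * (?p * d) < card (C1 q)" using d1' by linarith
    then show ?thesis using card1 by simp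
  qed
  then have "\<exists>f. inj_on f V1 \<and> (\<forall>q\<in>V1. f q \<in> C1 q - {})"
    by (intro greedy_selection_large fin1) auto
  then obtain f where f: "inj_on f V1" "\<And>q. q \<in> V1 \<Longrightarrow> f q \<in> C1 q" by auto
  \<comment> \<open>Below a copy that lies above \<open>X\<close>, the set \<open>X\<close> itself
    is a candidate (and dually), so the second level has to avoid it explicitly.\<close>
  define used where "used = insert X (f ` V1)"
  have fin_used: "finite used" and card_used: "card used \<le> 1 + ?p * d"
    using fin1 card_image_le[OF fin1, of f] card1 by (simp_all add: used_def card_insert_if)

  have "\<exists>v. (v, u) \<in> hasse_adj P \<and> hdist P x v = 1" if "u \<in> P" "hdist P x u = 2" for u
    using hdist_SucE[OF conn[OF that(1)], of 1] that(2) by auto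
  then obtain par where par: "\<And>u. u \<in> P \<Longrightarrow> hdist P x u = 2 \<Longrightarrow> (par u, u) \<in> hasse_adj P"
    "\<And>u. u \<in> P \<Longrightarrow> hdist P x u = 2 \<Longrightarrow> hdist P x (par u) = 1" by metis
  \<comment> \<open>The parent copy in the blow-up, by its block structure.\<close>
  define pa where "pa q = (par (fst q), snd q div d)" for q :: "'a set \<times> nat"
  have pa_V1: "pa q \<in> V1" if "q \<in> V2" for q
  proof -
    have u: "fst q \<in> P" "hdist P x (fst q) = 2" and "snd q < d * d" using that by (auto simp: V2_def)
    then have "par (fst q) \<in> P" "snd q div d < d"
      using hasse_adj_in[OF par(1)[OF u]] by (auto simp: less_mult_imp_div_less)
    then show ?thesis using par(2)[OF u] by (simp add: V1_def pa_def)
  qed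
  define pv where "pv q = f (pa q)" for q
  define C2 where "C2 q = (if hasse_edge P (par (fst q)) (fst q)
    then {B \<in> F. pv q \<subset> B} else {B \<in> F. B \<subset> pv q})" for q
  have rich2: "rich c n (pv q) (C2 q)" if q: "q \<in> V2" for q
  proof -
    let ?u = "fst q" and ?v = "par (fst q)"
    have u: "?u \<in> P" "hdist P x ?u = 2" using q by (auto simp: V2_def)
    have vu: "hasse_edge P ?v ?u \<or> hasse_edge P ?u ?v"
      using par(1)[OF u] by (auto simp: hasse_adj_def)
    have v: "?v \<in> P" "hdist P x ?v = 1" using par[OF u] hasse_adj_in by auto
    have in1: "pv q \<in> C1 (pa q)" unfolding pv_def by (rule f(2)[OF pa_V1[OF q]])
    show ?thesis
    \<comment> \<open>An upper joint is rich below in any case. If the edge continues upwards,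
      \<open>b2\<close> gives \<open>2 \<le> b\<close>, and then it is rich above too. Lower joints
      are dual.\<close>
    proof (cases "hasse_edge P x ?v")
      case True
      then have "pv q \<in> Up" using in1 by (simp add: C1_def pa_def)
      then show ?thesis using b2[OF True, of ?u] vu
        by (auto simp: Up_def upper_joints_def C2_def poor_above_def poor_below_def)
    next
      case False
      then have "hasse_edge P ?v x" using adj1[OF v] by auto
      moreover have "pv q \<in> Dn" using in1 False by (simp add: C1_def pa_def)
      ultimately show ?thesis using a2[of ?v ?u] vu
        by (auto simp: Dn_def lower_joints_def C2_def poor_above_def poor_below_def)
    qed
  qed

  define near where "near q = C2 q \<inter> cube_nbrs (pv q)" for q
  define V2a V2b where "V2a = {q \<in> V2. c * real n \<le> real (card (near q))}" and "V2b = V2 - V2a"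
  have V2ab: "V2a \<subseteq> V2" "V2b \<subseteq> V2" "V2a \<inter> V2b = {}" "V2 = V2a \<union> V2b"
    by (auto simp: V2a_def V2b_def)
  then have fin2ab: "finite V2a" "finite V2b" using finite_subset[OF _ fin2] by blast+
  have "\<exists>g. inj_on g V2a \<and> (\<forall>q\<in>V2a. g q \<in> near q - used)"
  proof (rule greedy_selection[OF fin2ab(1)])
    fix q J and g :: "'a set \<times> nat \<Rightarrow> nat set"
    assume q: "q \<in> V2a" and J: "J \<subseteq> V2a" and g: "\<And>j. j \<in> J \<Longrightarrow> g j \<in> near j - used"
    \<comment> \<open>A candidate is lost to \<open>used\<close>, to a sibling of \<open>q\<close>,
      or to a child of another parent, in which case it is one of at most two common neighbours of
      the two parents. With \<open>m = card P * d\<close> this excludes at most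
      \<open>(1 + m) + m + 2 * m\<close> sets, whence the \<open>1 + 4 * m\<close> in
      \<open>d1\<close>.\<close>
    let ?S = "{j \<in> J. pv j = pv q}"
    let ?N = "\<lambda>v. cube_nbrs (pv q) \<inter> cube_nbrs v"
    let ?R = "f ` V1 - {pv q}"
    \<comment> \<open>As \<open>f\<close> is injective, siblings have the same parent copy, so their
      indices lie in one block of length \<open>d\<close>.\<close>
    have "?S \<subseteq> P \<times> {(snd q div d) * d..<(snd q div d) * d + d}"
    proof
      fix j assume "j \<in> ?S"
      then have "pv j = pv q" and j: "j \<in> V2" using J V2ab by auto
      then have "pa j = pa q"
        using inj_onD[OF f(1), of "pa j" "pa q"] pa_V1 q V2ab by (auto simp: pv_def)
      then have eq: "snd j div d = snd q div d" by (simp add: pa_def)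
      have "0 < d" using j by (cases d) (auto simp: V2_def)
      then have "snd j mod d < d" by simp
      then have "(snd q div d) * d \<le> snd j" "snd j < (snd q div d) * d + d"
        using div_mult_mod_eq[of "snd j" d] unfolding eq[symmetric] by linarith+
      then show "j \<in> P \<times> {(snd q div d) * d..<(snd q div d) * d + d}"
        using j by (cases j) (auto simp: V2_def)
    qed
    note S_sub = this
    have S: "finite ?S" by (rule finite_subset[OF S_sub]) (use finP in simp)
    have card_S: "card ?S \<le> ?p * d"
      using card_mono[OF _ S_sub] finP by (simp add: card_cartesian_product)
    have R: "finite ?R" using fin1 by simp
    have "card ?R \<le> card (f ` V1)" using fin1 by (intro card_mono) auto
    then have card_R: "card ?R \<le> ?p * d" using card_image_le[OF fin1, of f] card1 by linarith
    have N: "finite (?N v)" "card (?N v) \<le> 2" if "v \<in> ?R" for v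
      using card_common_nbrs_le[of "pv q" v] that by auto
    have "card (\<Union>v\<in>?R. ?N v) \<le> (\<Sum>v\<in>?R. card (?N v))" by (rule card_UN_le[OF R])
    also have "\<dots> \<le> (\<Sum>v\<in>?R. 2)" by (intro sum_mono N)
    also have "\<dots> \<le> 2 * (?p * d)" using card_R by simp
    finally have NR: "card (\<Union>v\<in>?R. ?N v) \<le> 2 * (?p * d)" .
    define bad where "bad = used \<union> (g ` ?S \<union> (\<Union>v\<in>?R. ?N v))"
    have finB: "finite bad" unfolding bad_def using fin_used S R N(1) by blast
    have "card bad \<le> card used + (card (g ` ?S) + card (\<Union>v\<in>?R. ?N v))"
      unfolding bad_def by (meson card_Un_le order_trans add_left_mono)
    also have "\<dots> \<le> (1 + ?p * d) + (?p * d + 2 * (?p * d))"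
      using card_used card_image_le[OF S, of g] card_S NR by linarith
    finally have "card bad \<le> 1 + 4 * (?p * d)" by linarith
    moreover have "1 + 4 * (?p * d) < card (near q)"
      using d1' q unfolding V2a_def by (simp only: mem_Collect_eq) linarith
    ultimately have "\<not> near q \<subseteq> bad" using card_mono[OF finB, of "near q"] by linarith
    then obtain z where z: "z \<in> near q" "z \<notin> bad" by (metis subsetI)
    have "z \<notin> g ` J"
    proof
      assume "z \<in> g ` J"
      then obtain j where j: "z = g j" "j \<in> J" by (rule imageE)
      have "z \<in> near j" using g[OF j(2)] j(1) by simp
      then have "z \<in> ?N (pv j)" using z(1) by (simp add: near_def)
      moreover have "pv j \<noteq> pv q" using z(2) j by (auto simp: bad_def)
      then have "pv j \<in> ?R" using pa_V1[of j] j J V2ab by (auto simp: pv_def)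
      ultimately have "z \<in> bad" unfolding bad_def by (intro UnI2 UN_I)
      then show False using z(2) by simp
    qed
    moreover have "z \<in> near q - used" using z by (simp add: bad_def)
    ultimately show "\<exists>z\<in>near q - used. z \<notin> g ` J" by (intro bexI)
  qed
  then obtain g where g: "inj_on g V2a" "\<And>q. q \<in> V2a \<Longrightarrow> g q \<in> near q - used" by blast

  define used2 where "used2 = used \<union> g ` V2a"
  have fin_used2: "finite used2" using fin_used fin2ab by (simp add: used2_def)
  have "card used2 \<le> 1 + ?p * d + card V2a"
    using card_Un_le[of used "g ` V2a"] card_used card_image_le[OF fin2ab(1), of g]
    unfolding used2_def by linarith
  moreover have "card V2a + card V2b = card V2"
    using card_Un_disjoint[OF fin2ab V2ab(3)] V2ab(4) by simp
  ultimately have card_used2: "card used2 + card V2b \<le> 1 + ?p * d + ?p * (d * d)"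
    using card2 by linarith
  have "card used2 + card V2b < card (C2 q)" if q: "q \<in> V2b" for q
  proof -
    \<comment> \<open>Outside \<open>V2a\<close> the first alternative of richness fails, which
      leaves the quadratic one.\<close>
    have "c * (real n)\<^sup>2 \<le> real (card (C2 q))"
      using rich2[of q] q by (auto simp: rich_def V2b_def V2a_def near_def)
    then have "real (card used2 + card V2b) < real (card (C2 q))"
      using d2' card_used2 by linarith
    then show ?thesis by simp
  qed
  then have "\<exists>h. inj_on h V2b \<and> (\<forall>q\<in>V2b. h q \<in> C2 q - used2)"
    by (intro greedy_selection_large fin2ab fin_used2)
  then obtain h where h: "inj_on h V2b" "\<And>q. q \<in> V2b \<Longrightarrow> h q \<in> C2 q - used2" by blast

  define \<phi> where "\<phi> q = (if fst q = x then X else if q \<in> V1 then f q else if q \<in> V2a then g q else h q)"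
    for q :: "'a set \<times> nat"
  \<comment> \<open>At distance 0 there are \<open>d ^ 0 = 1\<close> copies, so the root occurs with
    index 0 only.\<close>
  have verts: "q = (x, 0) \<or> q \<in> V1 \<or> q \<in> V2a \<or> q \<in> V2b" if qv: "q \<in> blowup_vertices P x d" for q
  proof -
    obtain u i where q: "q = (u, i)" "u \<in> P" "i < d ^ hdist P x u"
      using qv by (auto simp: blowup_vertices_def)
    have "hdist P x u \<le> 2" using dist q(2) by blast
    then consider "hdist P x u = 0" | "hdist P x u = 1" | "hdist P x u = 2" by linarith
    then show ?thesis
    proof cases
      case 1
      then show ?thesis using hdist_eq_0D[OF conn[OF q(2)]] q by simp
    next
      case 2
      then show ?thesis using q by (simp add: V1_def)
    next
      case 3
      then have "q \<in> V2" using q by (simp add: V2_def power2_eq_square)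
      then show ?thesis using V2ab(4) by blast
    qed
  qed
  have not_x: "fst q \<noteq> x" if "q \<in> V1 \<or> q \<in> V2" for q using that by (auto simp: V1_def V2_def)
  have disj: "q \<notin> V1" if "q \<in> V2" for q using that by (auto simp: V1_def V2_def)
  have phi_x: "\<phi> (x, i) = X" for i by (simp add: \<phi>_def)
  have phi1: "\<phi> q = f q" if "q \<in> V1" for q using that not_x[of q] by (simp add: \<phi>_def)
  have phi2a: "\<phi> q = g q" if "q \<in> V2a" for q
    using that not_x[of q] disj[of q] V2ab by (auto simp: \<phi>_def)
  have phi2b: "\<phi> q = h q" if "q \<in> V2b" for q
    using that not_x[of q] disj[of q] V2ab by (auto simp: \<phi>_def)
  have phi2: "\<phi> q \<in> C2 q" if "q \<in> V2" for q
    using that V2ab(4) phi2a[of q] phi2b[of q] g(2)[of q] h(2)[of q] by (auto simp: near_def)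
  have X_F: "X \<in> F" using X by (simp add: roots_def)
  have f_F: "f q \<in> F" "f q \<noteq> X" if "q \<in> V1" for q
    using f(2)[OF that] sub by (auto simp: C1_def split: if_splits)

  have "inj_on \<phi> (blowup_vertices P x d)"
  proof -
    have "inj_on \<phi> V1" using f(1) phi1 by (simp cong: inj_on_cong)
    moreover have "inj_on \<phi> V2a" using g(1) phi2a by (simp cong: inj_on_cong)
    moreover have "inj_on \<phi> V2b" using h(1) phi2b by (simp cong: inj_on_cong)
    moreover have img: "\<phi> ` V1 = f ` V1" "\<phi> ` V2a = g ` V2a" "\<phi> ` V2b = h ` V2b"
      by (intro image_cong refl phi1 phi2a phi2b; assumption)+
    moreover have disj_img: "f ` V1 \<inter> (g ` V2a \<union> h ` V2b) = {}" "g ` V2a \<inter> h ` V2b = {}"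
      "X \<notin> f ` V1 \<union> (g ` V2a \<union> h ` V2b)"
      using g(2) h(2) f_F(2) unfolding used2_def used_def by blast+
    ultimately have "inj_on \<phi> (V1 \<union> (V2a \<union> V2b))"
      by (intro inj_on_UnI) (simp_all only: image_Un)
    moreover have "X \<notin> \<phi> ` (V1 \<union> (V2a \<union> V2b))"
      using disj_img(3) unfolding image_Un img .
    ultimately have "inj_on \<phi> (insert (x, 0) (V1 \<union> (V2a \<union> V2b)))"
      unfolding inj_on_insert using phi_x[of 0] by auto
    then show ?thesis by (rule inj_on_subset) (use verts in blast)
  qed
  moreover have "\<phi> ` blowup_vertices P x d \<subseteq> F"
  proof
    fix B assume "B \<in> \<phi> ` blowup_vertices P x d"
    then obtain q where q: "q \<in> blowup_vertices P x d" "B = \<phi> q" by blast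
    have "C2 q \<subseteq> F" by (auto simp: C2_def)
    then show "B \<in> F"
      using verts[OF q(1)] q(2) X_F phi_x f_F(1)[of q] phi1[of q] phi2[of q] V2ab(4) by auto
  qed
  moreover have "\<phi> p \<subseteq> \<phi> q" if "(p, q) \<in> (blowup_edges P x d)\<^sup>*" for p q
    using that
  proof (induction rule: rtrancl_induct)
    case (step q r)
    \<comment> \<open>By transitivity only single edges need checking, and each of them joins a copy
      to its parent copy in one of the two orientations.\<close>
    have child: "(hasse_edge P v u \<longrightarrow> \<phi> (v, i div d) \<subseteq> \<phi> (u, i)) \<and>
        (hasse_edge P u v \<longrightarrow> \<phi> (u, i) \<subseteq> \<phi> (v, i div d))"
      if u: "(u, i) \<in> blowup_vertices P x d" and v: "(v, i div d) \<in> blowup_vertices P x d"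
        and adj: "(v, u) \<in> hasse_adj P" and hd: "hdist P x u = hdist P x v + 1" for u v i
    proof -
      have "u \<in> P" "v \<in> P" using hasse_adj_in[OF adj] by auto
      then have "hdist P x u \<le> 2" using dist by blast
      then have "hdist P x u = 1 \<or> hdist P x u = 2" using hd by linarith
      then show ?thesis
      proof
        assume 1: "hdist P x u = 1"
        then have "v = x" using hd hdist_eq_0D[OF conn[OF \<open>v \<in> P\<close>]] by simp
        moreover have q: "(u, i) \<in> V1" using u 1 by (auto simp: V1_def blowup_vertices_def)
        moreover have "\<not> (hasse_edge P u x \<and> hasse_edge P x u)" by (auto simp: hasse_edge_def)
        ultimately show ?thesis
          using f(2)[OF q] by (auto simp: phi_x phi1[OF q] C1_def split: if_splits)
      next
        assume 2: "hdist P x u = 2"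
        then have q: "(u, i) \<in> V2" using u by (auto simp: V2_def blowup_vertices_def power2_eq_square)
        \<comment> \<open>The candidates in \<open>C2\<close> refer to the chosen parent; in a tree
          there is no other one.\<close>
        have "v = par u"
          using tree_parent_unique[OF P adj _ par(1)[OF \<open>u \<in> P\<close> 2]] par(2)[OF \<open>u \<in> P\<close> 2] hd 2 by simp
        then have "pa (u, i) = (v, i div d)" by (simp add: pa_def)
        moreover have "\<not> (hasse_edge P u v \<and> hasse_edge P v u)" by (auto simp: hasse_edge_def)
        ultimately show ?thesis
          using phi2[OF q] phi1[OF pa_V1[OF q]] \<open>v = par u\<close>
          by (auto simp: C2_def pv_def split: if_splits)
      qed
    qed
    obtain a i b j where e: "q = (a, i)" "r = (b, j)" by (cases q, cases r)
    have "\<phi> q \<subseteq> \<phi> r"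
      using step.hyps(2) child[of b j a] child[of a i b]
      unfolding e by (auto simp: blowup_edges_def hasse_adj_def)
    then show ?case using step.IH by blast
  qed simp
  ultimately show ?thesis unfolding contains_blowup_def by blast
qed

section \<open>Depths around the root, choice of the constants and conclusion\<close>

lemma contains_blowup_mono:
  assumes "contains_blowup G P x d" "G \<subseteq> F"
  shows "contains_blowup F P x d"
proof -
  obtain \<phi> where \<phi>: "inj_on \<phi> (blowup_vertices P x d) \<and> \<phi> ` blowup_vertices P x d \<subseteq> G \<and>
      (\<forall>p\<in>blowup_vertices P x d. \<forall>q\<in>blowup_vertices P x d.
        (p, q) \<in> (blowup_edges P x d)\<^sup>* \<longrightarrow> \<phi> p \<subseteq> \<phi> q)"
    using assms(1) unfolding contains_blowup_def by (rule exE)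
  moreover from \<phi> have "\<phi> ` blowup_vertices P x d \<subseteq> F" using assms(2) by (elim conjE) (rule subset_trans)
  ultimately show ?thesis unfolding contains_blowup_def by (intro exI[of _ \<phi>]) (elim conjE, intro conjI)
qed

lemma height_ge:
  assumes "is_poset P" "C \<subseteq> P" "is_chain C"
  shows "card C \<le> height P"
proof -
  have "finite P" using assms(1) by (simp add: is_poset_def)
  moreover have "{card C | C. C \<subseteq> P \<and> is_chain C} \<subseteq> card ` Pow P" by blast
  ultimately have "finite {card C | C. C \<subseteq> P \<and> is_chain C}" by (simp add: finite_subset)
  moreover have "card C \<in> {card C | C. C \<subseteq> P \<and> is_chain C}" using assms(2,3) by blast
  ultimately show ?thesis unfolding height_def by (rule Max_ge)
qed

text \<open>Follow Hasse edges upwards from \<open>x\<close> for as long as possible, but at most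
  two steps. The size of the resulting chain serves as \<open>b\<close>, and the last two clauses
  become \<open>b1\<close> and \<open>b2\<close>.\<close>

lemma chain_above_exists:
  "\<exists>C\<subseteq>P. is_chain C \<and> (\<forall>A\<in>C. x \<subset> A) \<and> (\<forall>u. hasse_edge P x u \<longrightarrow> 1 \<le> card C) \<and>
    (\<forall>u v. hasse_edge P x u \<longrightarrow> hasse_edge P u v \<longrightarrow> 2 \<le> card C)"
proof -
  consider u v where "hasse_edge P x u" "hasse_edge P u v"
    | u where "hasse_edge P x u" "\<nexists>u v. hasse_edge P x u \<and> hasse_edge P u v"
    | "\<nexists>u. hasse_edge P x u" by blast
  then show ?thesis
  proof cases
    case (1 u v)
    then have "u \<noteq> v" "{u, v} \<subseteq> P" "x \<subset> u" "u \<subset> v" by (auto simp: hasse_edge_def)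
    then show ?thesis by (intro exI[of _ "{u, v}"]) (auto simp: is_chain_def)
  next
    case (2 u)
    then have "u \<in> P" "x \<subset> u" by (auto simp: hasse_edge_def)
    then show ?thesis using 2(2) by (intro exI[of _ "{u}"]) (auto simp: is_chain_def)
  next
    case 3
    then show ?thesis by (intro exI[of _ "{}"]) (auto simp: is_chain_def)
  qed
qed

lemma chain_below_exists:
  "\<exists>C\<subseteq>P. is_chain C \<and> (\<forall>A\<in>C. A \<subset> x) \<and> (\<forall>u. hasse_edge P u x \<longrightarrow> 1 \<le> card C) \<and>
    (\<forall>u v. hasse_edge P u x \<longrightarrow> hasse_edge P v u \<longrightarrow> 2 \<le> card C)"
proof -
  consider u v where "hasse_edge P u x" "hasse_edge P v u"
    | u where "hasse_edge P u x" "\<nexists>u v. hasse_edge P u x \<and> hasse_edge P v u"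
    | "\<nexists>u. hasse_edge P u x" by blast
  then show ?thesis
  proof cases
    case (1 u v)
    then have "u \<noteq> v" "{u, v} \<subseteq> P" "u \<subset> x" "v \<subset> u" by (auto simp: hasse_edge_def)
    then show ?thesis by (intro exI[of _ "{u, v}"]) (auto simp: is_chain_def)
  next
    case (2 u)
    then have "u \<in> P" "u \<subset> x" by (auto simp: hasse_edge_def)
    then show ?thesis using 2(2) by (intro exI[of _ "{u}"]) (auto simp: is_chain_def)
  next
    case 3
    then show ?thesis by (intro exI[of _ "{}"]) (auto simp: is_chain_def)
  qed
qed

theorem theorem1p7:
  fixes P :: "'a set set" and x :: "'a set"
  assumes "tree_poset P" and "x \<in> P" and "\<forall>u\<in>P. hdist P x u \<le> 2"
  shows "\<forall>eps::real. eps > 0 \<longrightarrow> (\<exists>del::real. del > 0 \<and> (\<exists>N::nat. \<forall>n\<ge>N. \<forall>F::nat set set.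
           F \<subseteq> Pow {1..n} \<and>
           real (card F) \<ge> (real (height P) - 1 + eps) * real (n choose (n div 2))
           \<longrightarrow> contains_blowup F P x (nat (floor (del * real n)))))"
proof (intro allI impI)
  fix eps :: real assume eps: "0 < eps"
  have poset: "is_poset P" "finite P" using assms(1) by (auto simp: tree_poset_def is_poset_def)
  obtain C1 where C1: "C1 \<subseteq> P" "is_chain C1" "\<forall>A\<in>C1. x \<subset> A"
    and b12: "\<forall>u. hasse_edge P x u \<longrightarrow> 1 \<le> card C1"
      "\<forall>u v. hasse_edge P x u \<longrightarrow> hasse_edge P u v \<longrightarrow> 2 \<le> card C1"
    using chain_above_exists[of P x] by (elim exE conjE) (rule that)
  obtain C2 where C2: "C2 \<subseteq> P" "is_chain C2" "\<forall>A\<in>C2. A \<subset> x"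
    and a12: "\<forall>u. hasse_edge P u x \<longrightarrow> 1 \<le> card C2"
      "\<forall>u v. hasse_edge P u x \<longrightarrow> hasse_edge P v u \<longrightarrow> 2 \<le> card C2"
    using chain_below_exists[of P x] by (elim exE conjE) (rule that)
  define a b where "a = card C2" and "b = card C1"
  have fin: "finite C1" "finite C2" using finite_subset[OF C1(1) poset(2)] finite_subset[OF C2(1) poset(2)] by simp_all
  have above: "x \<subseteq> A" if "A \<in> C1" for A using C1(3) that by blast
  have below: "A \<subseteq> x" if "A \<in> C2" for A using C2(3) that by blast
  \<comment> \<open>All of \<open>C2\<close> lies below \<open>x\<close> and all of
    \<open>C1\<close> above it; the joint chain shows that \<open>a + b\<close> is at most the
    height minus 1.\<close>
  have "is_chain (insert x (C1 \<union> C2))"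
    using C1(2) C2(2) above below order_trans[of _ x]
    unfolding is_chain_def by (metis UnE insertE order_refl)
  then have "card (insert x (C1 \<union> C2)) \<le> height P"
    using C1(1) C2(1) assms(2) by (intro height_ge poset) auto
  moreover have "C1 \<inter> C2 = {}" using C1(3) C2(3) by blast
  then have "card (C1 \<union> C2) = b + a"
    using fin by (simp add: card_Un_disjoint a_def b_def)
  moreover have "x \<notin> C1 \<union> C2" using C1(3) C2(3) by blast
  ultimately have height: "a + b + 1 \<le> height P" using fin by simp

  \<comment> \<open>One half of \<open>eps\<close> pays for the non-central sets, the other half is
    the excess in \<open>roots_nonempty\<close>.\<close>
  define e s where "e = eps / 2" and "s = real (a + b)"
  have e: "0 < e" and s: "0 \<le> s" using eps by (auto simp: e_def s_def)
  \<comment> \<open>As \<open>q\<close> exceeds both \<open>s + e\<close> and \<open>e\<close>, this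
    gives \<open>272 * c * (s + e) < 300 * c * q = e\<close> and \<open>c < 1\<close>.\<close>
  define q c where "q = 1 + s + e" and "c = e / (300 * q)"
  have q: "1 + e \<le> q" "s + e < q" using s by (auto simp: q_def)
  have c0: "0 < c" using e q by (simp add: c_def)
  have c1: "c < 1" using e q by (simp add: c_def divide_less_eq)
  have c_small: "272 * c * (s + e) < e"
  proof -
    have "272 * c * (s + e) < 300 * c * q"
      by (rule mult_strict_mono) (use c0 e s q in auto)
    also have "\<dots> = e" using e q by (simp add: c_def)
    finally show ?thesis .
  qed
  define p where "p = real (card P)"
  have p: "1 \<le> p" using poset assms(2) card_gt_0_iff[of P] by (auto simp: p_def Suc_le_eq)
  \<comment> \<open>Then \<open>p * d \<le> c * n / 10\<close>, so \<open>4 * p * d\<close> takes up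
    at most two fifths of \<open>c * n\<close>, and the 1 in \<open>d1\<close> at most a third once
    \<open>c * n \<ge> 3\<close>.\<close>
  define del where "del = c / (10 * p)"
  have del: "0 < del" using c0 p by (simp add: del_def)
  obtain N0 where N0: "\<And>n S. n \<ge> N0 \<Longrightarrow> finite (S :: nat set) \<Longrightarrow> card S = n \<Longrightarrow>
      real (card (Pow S - central S)) \<le> e * real (n choose (n div 2))"
    using noncentral_negligible[OF e, where 'a = nat] unfolding eventually_sequentially by blast
  \<comment> \<open>\<open>N0\<close> makes the non-central sets negligible, 8 serves the estimates
    on chains, and \<open>3 / c\<close> ensures \<open>c * n \<ge> 3\<close>.\<close>
  define N where "N = max (max N0 8) (nat \<lceil>3 / c\<rceil>)"
  show "\<exists>del::real. del > 0 \<and> (\<exists>N::nat. \<forall>n\<ge>N. \<forall>F::nat set set. F \<subseteq> Pow {1..n} \<and>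
      real (card F) \<ge> (real (height P) - 1 + eps) * real (n choose (n div 2))
      \<longrightarrow> contains_blowup F P x (nat (floor (del * real n))))"
  proof (rule exI[of _ del], rule conjI[OF del], rule exI[of _ N], intro allI impI)
    fix n and F :: "nat set set"
    assume n: "N \<le> n"
      and "F \<subseteq> Pow {1..n} \<and> (real (height P) - 1 + eps) * real (n choose (n div 2)) \<le> real (card F)"
    then have F: "F \<subseteq> Pow {1..n}"
      and large: "(real (height P) - 1 + eps) * real (n choose (n div 2)) \<le> real (card F)" by auto
    let ?S = "{1..n}" and ?m = "real (n choose (n div 2))"
    have n8: "8 \<le> n" "N0 \<le> n" using n by (auto simp: N_def)
    have "3 / c \<le> real n" using n by (auto simp: N_def)
    then have cn: "3 \<le> c * real n" using c0 by (simp add: field_simps)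
    define G where "G = F \<inter> central ?S"
    have finF: "finite F" using F by (rule finite_subset) simp
    have "F \<subseteq> G \<union> (Pow ?S - central ?S)" using F by (auto simp: G_def)
    then have "card F \<le> card (G \<union> (Pow ?S - central ?S))"
      using finF by (intro card_mono) (auto simp: G_def)
    also have "\<dots> \<le> card G + card (Pow ?S - central ?S)" by (rule card_Un_le)
    finally have "real (card F) \<le> real (card G) + real (card (Pow ?S - central ?S))" by linarith
    moreover have "real (card (Pow ?S - central ?S)) \<le> e * ?m" using N0[OF n8(2), of ?S] by simp
    ultimately have "real (card F) \<le> real (card G) + e * ?m" by linarith
    moreover have "(s + 2 * e) * ?m \<le> (real (height P) - 1 + eps) * ?m"
      using height by (intro mult_right_mono) (auto simp: s_def e_def)
    ultimately have "(s + 2 * e) * ?m \<le> real (card G) + e * ?m" using large by linarith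
    then have "(s + e) * ?m \<le> real (card G)" by (simp add: algebra_simps)
    then have "roots c (card ?S) a b G \<noteq> {}"
      using n8 e c0 c_small by (intro roots_nonempty[of ?S G e]) (auto simp: G_def s_def)
    then obtain X where X: "X \<in> roots c n a b G" by auto
    define d where "d = nat (floor (del * real n))"
    have d: "real d \<le> del * real n" using del by (simp add: d_def)
    have pd: "p * real d \<le> c * real n / 10"
    proof -
      have "p * real d \<le> p * (del * real n)" using d p by (intro mult_left_mono) auto
      also have "\<dots> = c * real n / 10" using p by (simp add: del_def)
      finally show ?thesis .
    qed
    have dn: "real d \<le> real n"
    proof -
      have "1 * real d \<le> p * real d" using p by (intro mult_right_mono) auto
      also note pd
      also have "c * real n \<le> 1 * real n" using c1 by (intro mult_right_mono) auto
      finally show ?thesis by simp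
    qed
    have d1: "1 + 4 * (real (card P) * real d) < c * real n"
      using pd cn unfolding p_def by linarith
    have d2: "1 + real (card P) * real d + real (card P) * (real d)\<^sup>2 < c * (real n)\<^sup>2"
    proof -
      have "p * (real d)\<^sup>2 = (p * real d) * real d" by (simp add: power2_eq_square)
      \<comment> \<open>One factor \<open>d\<close> is absorbed by
        \<open>p * d \<le> c * n / 10\<close>, the other by \<open>d \<le> n\<close>.\<close>
      also have "\<dots> \<le> (c * real n / 10) * real n" using pd dn c0 by (intro mult_mono) auto
      finally have "p * (real d)\<^sup>2 \<le> c * real n * real n / 10" by simp
      moreover have "c * real n * 1 \<le> c * real n * real n"
        using n8 c0 by (intro mult_left_mono) auto
      ultimately have "1 + p * real d + p * (real d)\<^sup>2 < c * real n * real n"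
        using pd cn by linarith
      then show ?thesis by (simp add: p_def power2_eq_square mult.assoc)
    qed
    have "contains_blowup G P x d"
      using c0 n8 finF
      by (intro contains_blowup_of_root[OF assms _ _ _ X _ _ _ _ d1 d2])
        (use a12 b12 in \<open>auto simp: G_def a_def b_def\<close>)
    then have "contains_blowup F P x d" by (rule contains_blowup_mono) (simp add: G_def)
    then show "contains_blowup F P x (nat (floor (del * real n)))" by (simp add: d_def)
  qed
qed

end
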